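(* There exists some $\mathcal{D}\subseteq \mathcal{S}^1$ of lower box dimension $0$ that is Bourgain universal for the class of analytic subsets of $\mathbb{R}^2$.
   Context: $\mathcal{S}^1$ is the unit circle in $\mathbb{R}^2$. For $e\in\mathcal{S}^1$ and $x\in\mathbb{R}^2$, $p_ex=e\cdot x$ and $p_eE=\{p_ex:x\in E\}$. A set $\mathcal{D}\subseteq\mathcal{S}^1$ is Bourgain universal for a class $\mathcal{C}$ of subsets of $\mathbb{R}^2$ if for every $E\in\mathcal{C}$ there is a direction $e\in\mathcal{D}$ such that $\dim_H(p_eE)\ge\frac{\dim_H(E)}{2}$, where $\dim_H$ is Hausdorff dimension. *)

theory Defs
  imports "HOL-Analysis.Analysis"
begin

(* The case split implements 0^0 = 1 for nonempty sets, whereas 0 powr 0 = 0. *)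
definition diam_pow :: "real \<Rightarrow> 'a::metric_space set \<Rightarrow> ennreal" where
  "diam_pow s U = (if U = {} then 0 else if s = 0 then 1 else ennreal (diameter U powr s))"

(* Boundedness is explicit because diameter is a junk value on unbounded sets. *)
definition hausdorff_premeasure :: "real \<Rightarrow> real \<Rightarrow> 'a::metric_space set \<Rightarrow> ennreal" where
  "hausdorff_premeasure s \<delta> E =
     (INF U \<in> {U :: nat \<Rightarrow> 'a set. E \<subseteq> (\<Union>i. U i) \<and> (\<forall>i. bounded (U i) \<and> diameter (U i) \<le> \<delta>)}.
        \<Sum>i. diam_pow s (U i))"

definition hausdorff_measure :: "real \<Rightarrow> 'a::metric_space set \<Rightarrow> ennreal" where
  "hausdorff_measure s E = (SUP \<delta> \<in> {0<..}. hausdorff_premeasure s \<delta> E)"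

definition hausdorff_dim :: "'a::metric_space set \<Rightarrow> ereal" where
  "hausdorff_dim E = (INF s \<in> {s. 0 \<le> s \<and> hausdorff_measure s E = 0}. ereal s)"

(* Least number of sets of diameter at most \<delta> needed to cover A; meaningful for
   bounded A and \<delta> > 0, where a finite cover exists. *)
definition covering_number :: "real \<Rightarrow> 'a::euclidean_space set \<Rightarrow> nat" where
  "covering_number \<delta> A =
     (LEAST n. \<exists>\<U>. finite \<U> \<and> card \<U> = n \<and> A \<subseteq> \<Union>\<U> \<and>
                 (\<forall>U\<in>\<U>. bounded U \<and> diameter U \<le> \<delta>))"

(* Intended for nonempty bounded A. *)
definition lower_box_dim :: "'a::euclidean_space set \<Rightarrow> ereal" where
  "lower_box_dim A =
     Liminf (at_right 0) (\<lambda>\<delta>. ereal (ln (real (covering_number \<delta> A)) / ln (1 / \<delta>)))"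

(* The type nat \<Rightarrow> nat carries the product of the discrete topologies, i.e. it is
   Baire space: analytic sets are its continuous images, together with {}. *)
definition analytic_set :: "'a::topological_space set \<Rightarrow> bool" where
  "analytic_set A \<longleftrightarrow>
     A = {} \<or> (\<exists>f :: (nat \<Rightarrow> nat) \<Rightarrow> 'a. continuous_on UNIV f \<and> A = range f)"

definition dir_proj :: "real^2 \<Rightarrow> real^2 \<Rightarrow> real" where
  "dir_proj e x = e \<bullet> x"

definition bourgain_universal :: "(real^2) set \<Rightarrow> (real^2) set set \<Rightarrow> bool" where
  "bourgain_universal D \<C> \<longleftrightarrow>
     D \<subseteq> sphere 0 1 \<and>
     (\<forall>E\<in>\<C>. \<exists>e\<in>D. hausdorff_dim (dir_proj e ` E) \<ge> hausdorff_dim E / 2)"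

end

theory Submission
  imports Defs "HOL-Real_Asymp.Real_Asymp"
begin

text \<open>
Let \<open>E\<close> be analytic and \<open>2 u < t < dim E\<close>. The aim is a direction in which the projection
of \<open>E\<close> has positive \<open>u\<close>-dimensional Hausdorff measure, and a very small set of directions in which
to look for it.

The set \<open>E\<close> contains a compact set \<open>K\<close> of positive \<open>t\<close>-dimensional dyadic content
(\<open>analytic_has_compact_subset\<close>). So \<open>K\<close> carries, for every finite resolution \<open>n\<close>, a discrete weight
\<open>m\<close> of fixed total mass \<open>c\<close> that gives every dyadic square of side \<open>2^-j\<close>, \<open>j \<le> n\<close>, a mass of at most
\<open>2^(-t j)\<close> (\<open>exists_frostman_weight\<close>). Call an angle bad at scale \<open>l\<close> if some set that carries a
fraction \<open>1 / ((l+1) (l+2))\<close> of the mass projects into at most \<open>2^(u l)\<close> intervals of length about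
\<open>2^-l\<close>. These fractions have sum \<open>1\<close>; hence, if the projection of \<open>K\<close> had an economical cover by
short intervals, sorting the intervals by length would reveal a scale at which the angle is bad
(\<open>small_cover_bad_angle\<close>).

The exponent one half enters through two strips crossing. Suppose that two angles at distance at
least \<open>2^-M\<close> are bad at scale \<open>l\<close>, with heavy sets \<open>X\<close> and \<open>X'\<close>. Then \<open>X \<inter> X'\<close> lies in
\<open>2^(2 u l)\<close> parallelograms of diameter about \<open>2^(M-l)\<close>, and so has mass about
\<open>2^(2 u l - t (l - M))\<close>. This is negligible when \<open>M\<close> is small compared with \<open>l\<close>, since \<open>2 u < t\<close>.
Thus the heavy sets of \<open>2^-M\<close>-separated bad angles are almost disjoint and each has mass of order
\<open>l^-2\<close>, so there are only \<open>O(l^2)\<close> of them, however many angles are offered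
(\<open>card_bad_angles\<close>).

A set of directions therefore needs only polynomially many alternatives per scale. The angles used
here are essentially the sums \<open>a\<^sub>0 2^-p\<^sub>0 + a\<^sub>1 2^-p\<^sub>1 + \<dots>\<close> with digits \<open>a\<^sub>k < 2^(10 k + 22)\<close> at the positions
\<open>p\<^sub>k = 2^(k+8)\<close>. The digit \<open>a\<^sub>k\<close> serves the scales \<open>4^k \<le> l < 4^(k+1)\<close>: changing it
alone produces angles that are separated by \<open>2^-p\<^sub>k\<close>, with \<open>p\<^sub>k = O(sqrt l)\<close>, so the proportion of
bad values of \<open>a\<^sub>k\<close> is \<open>O(l^2 / 2^(10 k))\<close>, whatever the other digits are. A union bound yields for
every resolution an angle that is bad at no relevant scale (\<open>exists_good_angle\<close>), and a limit point of
these angles works for \<open>K\<close> by compactness (\<open>exists_universal_angle\<close>). The argument treats a sequence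
of triples \<open>(K, t, u)\<close> simultaneously, so rational \<open>t\<close> and \<open>u\<close> give the bound with \<open>dim E / 2\<close> itself.

On the other hand, the first \<open>k\<close> digits take at most \<open>2^(22 k^2)\<close> values, and the later ones move
the angle by at most \<open>2^-(2^k)\<close>. So at the scales \<open>\<delta> = 4 * 2^-(2^k)\<close> the covering number is only
\<open>exp (O((log log (1/\<delta>))^2))\<close>, and the lower box dimension is \<open>0\<close>
(\<open>lower_box_dim_directions\<close>).
\<close>

section \<open>Dyadic net content\<close>

definition cell :: "nat \<Rightarrow> real^2 \<Rightarrow> int \<times> int" where
  "cell n x = (\<lfloor>2 ^ n * x $ 1\<rfloor>, \<lfloor>2 ^ n * x $ 2\<rfloor>)"

lemma floor_dyadic_coarsen:
  fixes x y :: real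
  assumes "\<lfloor>2 ^ n * x\<rfloor> = \<lfloor>2 ^ n * y\<rfloor>" "m \<le> n"
  shows "\<lfloor>2 ^ m * x\<rfloor> = \<lfloor>2 ^ m * y\<rfloor>"
proof -
  have *: "\<lfloor>2 ^ m * z\<rfloor> = \<lfloor>2 ^ n * z\<rfloor> div 2 ^ (n - m)" for z :: real
  proof -
    have "2 ^ m * z = (2 ^ n * z) / real_of_int (2 ^ (n - m))"
      using assms(2) by (simp add: field_simps flip: power_add)
    then show ?thesis
      by (metis floor_divide_real_eq_div zero_le_numeral zero_le_power)
  qed
  show ?thesis
    unfolding * assms(1) ..
qed

lemma cell_coarsen: "cell n x = cell n y \<Longrightarrow> m \<le> n \<Longrightarrow> cell m x = cell m y"
  unfolding cell_def by (auto intro: floor_dyadic_coarsen)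

text \<open>
A node \<open>(n, v)\<close> stands for the half-open dyadic square of side \<open>2^-n\<close> with index \<open>v\<close>, and has weight
\<open>2^(-t n)\<close>. The total weight of a family of nodes is written as a measure, so that
additivity and continuity of countable sums come from measure theory.
\<close>

definition net_measure :: "real \<Rightarrow> (nat \<times> int \<times> int) measure" where
  "net_measure t = density (count_space UNIV) (\<lambda>(n, _). ennreal (2 powr (- t * real n)))"

definition net_covers :: "(nat \<times> int \<times> int) set \<Rightarrow> (real^2) set \<Rightarrow> bool" where
  "net_covers C A \<longleftrightarrow> (\<forall>x\<in>A. \<exists>n. (n, cell n x) \<in> C)"

text \<open>
The dyadic counterpart of the \<open>t\<close>-dimensional Hausdorff content. Hausdorff content itself is harder to
handle, because arbitrary covering sets are not nested; nestedness is what makes the content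
strongly subadditive below.
\<close>

definition net_content :: "real \<Rightarrow> (real^2) set \<Rightarrow> ennreal" where
  "net_content t A = (INF C \<in> {C. net_covers C A}. emeasure (net_measure t) C)"

lemma sets_net_measure [simp]: "sets (net_measure t) = UNIV"
  unfolding net_measure_def by simp

lemma emeasure_net_measure:
  "emeasure (net_measure t) C =
     (\<integral>\<^sup>+v. ennreal (2 powr (- t * real (fst v))) * indicator C v \<partial>count_space UNIV)"
  unfolding net_measure_def
  by (subst emeasure_density) (auto simp: case_prod_beta intro!: nn_integral_cong)

lemma emeasure_net_measure_singleton:
  "emeasure (net_measure t) {v} = ennreal (2 powr (- t * real (fst v)))"
  unfolding emeasure_net_measure by (subst nn_integral_indicator_singleton) auto

lemma emeasure_net_measure_finite:
  assumes "finite C"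
  shows "emeasure (net_measure t) C = ennreal (\<Sum>v\<in>C. 2 powr (- t * real (fst v)))"
proof -
  have "emeasure (net_measure t) C = (\<Sum>v\<in>C. emeasure (net_measure t) {v})"
    using assms by (intro emeasure_eq_sum_singleton) auto
  also have "\<dots> = ennreal (\<Sum>v\<in>C. 2 powr (- t * real (fst v)))"
    unfolding emeasure_net_measure_singleton by (intro sum_ennreal) auto
  finally show ?thesis .
qed

lemma net_content_le: "net_covers C A \<Longrightarrow> net_content t A \<le> emeasure (net_measure t) C"
  unfolding net_content_def by (auto intro: INF_lower)

lemma net_content_less_cover:
  "net_content t A < b \<Longrightarrow> \<exists>C. net_covers C A \<and> emeasure (net_measure t) C < b"
  unfolding net_content_def by (auto simp: INF_less_iff)

lemma net_covers_subset: "net_covers C B \<Longrightarrow> A \<subseteq> B \<Longrightarrow> net_covers C A"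
  unfolding net_covers_def by blast

lemma net_content_mono: "A \<subseteq> B \<Longrightarrow> net_content t A \<le> net_content t B"
  unfolding net_content_def by (rule INF_superset_mono) (auto intro: net_covers_subset)

definition maximal_nodes :: "(nat \<times> int \<times> int) set \<Rightarrow> (nat \<times> int \<times> int) set" where
  "maximal_nodes C =
     {(n, cell n x) | n x. (n, cell n x) \<in> C \<and> (\<forall>m<n. (m, cell m x) \<notin> C)}"

lemma maximal_nodes_iff:
  "(n, cell n x) \<in> maximal_nodes C \<longleftrightarrow>
     (n, cell n x) \<in> C \<and> (\<forall>m<n. (m, cell m x) \<notin> C)"
proof
  assume "(n, cell n x) \<in> maximal_nodes C"
  then obtain y where y: "cell n x = cell n y" "(n, cell n y) \<in> C"
      "\<forall>m<n. (m, cell m y) \<notin> C"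
    unfolding maximal_nodes_def by blast
  then show "(n, cell n x) \<in> C \<and> (\<forall>m<n. (m, cell m x) \<notin> C)"
    using cell_coarsen[OF y(1)] by auto
qed (auto simp: maximal_nodes_def)

lemma maximal_nodes_subset: "maximal_nodes C \<subseteq> C"
  unfolding maximal_nodes_def by blast

lemma net_covers_maximal_nodes:
  assumes "net_covers C A"
  shows "net_covers (maximal_nodes C) A"
  unfolding net_covers_def
proof
  fix x assume "x \<in> A"
  then have ex: "\<exists>n. (n, cell n x) \<in> C"
    using assms unfolding net_covers_def by blast
  define n where "n = (LEAST n. (n, cell n x) \<in> C)"
  have "(n, cell n x) \<in> C" "\<forall>m<n. (m, cell m x) \<notin> C"
    unfolding n_def using LeastI_ex[OF ex] not_less_Least by blast+
  then show "\<exists>n. (n, cell n x) \<in> maximal_nodes C"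
    unfolding maximal_nodes_iff by blast
qed

text \<open>
Of two squares that contain the same point, one contains the other. Keep the maximal squares of
\<open>C \<union> C'\<close>: they still cover \<open>A \<union> B\<close>. A point of \<open>A \<inter> B\<close> lies in a square of each
family; either these coincide, or the smaller one has been discarded. So the discarded squares together
with \<open>C \<inter> C'\<close> cover \<open>A \<inter> B\<close>, and nothing has been counted more than twice.
\<close>

lemma net_strong_subadditivity:
  assumes "net_covers C A" "net_covers C' B"
  shows "emeasure (net_measure t) (maximal_nodes (C \<union> C')) + net_content t (A \<inter> B)
           \<le> emeasure (net_measure t) C + emeasure (net_measure t) C'"
proof -
  let ?W = "emeasure (net_measure t)"
  let ?U = "maximal_nodes (C \<union> C')"
  let ?V = "((C \<union> C') - ?U) \<union> (C \<inter> C')"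
  have "net_covers ?V (A \<inter> B)"
    unfolding net_covers_def
  proof
    fix x assume "x \<in> A \<inter> B"
    then obtain n n' where n: "(n, cell n x) \<in> C" "(n', cell n' x) \<in> C'"
      using assms unfolding net_covers_def by blast
    consider "n < n'" | "n' < n" | "n = n'" by linarith
    then show "\<exists>n. (n, cell n x) \<in> ?V"
    proof cases
      case 1
      then have "(n', cell n' x) \<notin> ?U" unfolding maximal_nodes_iff using n by blast
      then show ?thesis using n by blast
    next
      case 2
      then have "(n, cell n x) \<notin> ?U" unfolding maximal_nodes_iff using n by blast
      then show ?thesis using n by blast
    next
      case 3
      then show ?thesis using n by blast
    qed
  qed
  then have "net_content t (A \<inter> B) \<le> ?W ?V" by (rule net_content_le)
  also have "\<dots> \<le> ?W ((C \<union> C') - ?U) + ?W (C \<inter> C')"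
    by (rule emeasure_subadditive) auto
  finally have "?W ?U + net_content t (A \<inter> B)
      \<le> (?W ?U + ?W ((C \<union> C') - ?U)) + ?W (C \<inter> C')"
    by (simp add: add_left_mono add.assoc)
  also have "?W ?U + ?W ((C \<union> C') - ?U) = ?W (C \<union> C')"
    using maximal_nodes_subset[of "C \<union> C'"]
    by (subst plus_emeasure) (auto intro!: arg_cong[where f = ?W])
  also have "?W (C \<union> C') + ?W (C \<inter> C') = ?W C + ?W C'"
    by (rule emeasure_Un_Int[symmetric]) auto
  finally show ?thesis .
qed

text \<open>
Merge nearly optimal covers \<open>C k\<close> of the sets \<open>A k\<close> one after the other, keeping maximal squares
only. By strong subadditivity the \<open>k\<close>-th merge \<open>D k\<close> exceeds the content of \<open>A k\<close> only by the
accumulated errors. The square of \<open>D k\<close> that contains a given point can only grow with \<open>k\<close>, hence it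
stabilizes, and the stable squares cover the union.
\<close>

lemma net_content_increasing_union:
  fixes A :: "nat \<Rightarrow> (real^2) set" and c :: real
  assumes "incseq A" and bound: "\<And>k. net_content t (A k) \<le> ennreal c" and "c \<ge> 0"
  shows "net_content t (\<Union>k. A k) \<le> ennreal c"
proof (rule ennreal_le_epsilon)
  fix \<epsilon> :: real assume "\<epsilon> > 0"
  let ?W = "emeasure (net_measure t)"
  have "\<exists>C. net_covers C (A k) \<and> ?W C < net_content t (A k) + ennreal (\<epsilon> / 2 ^ Suc k)" for k
  proof (rule net_content_less_cover)
    have "net_content t (A k) \<noteq> \<infinity>" using bound[of k] by (auto simp: top_unique)
    then show "net_content t (A k) < net_content t (A k) + ennreal (\<epsilon> / 2 ^ Suc k)"
      using \<open>\<epsilon> > 0\<close>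
        ennreal_add_left_cancel_less[of "net_content t (A k)" 0 "ennreal (\<epsilon> / 2 ^ Suc k)"]
      by simp
  qed
  then obtain C where C: "\<And>k. net_covers (C k) (A k)"
      "\<And>k. ?W (C k) < net_content t (A k) + ennreal (\<epsilon> / 2 ^ Suc k)" by metis
  define D where "D = rec_nat (maximal_nodes (C 0)) (\<lambda>k X. maximal_nodes (X \<union> C (Suc k)))"
  have D0: "D 0 = maximal_nodes (C 0)" and DS: "D (Suc k) = maximal_nodes (D k \<union> C (Suc k))" for k
    unfolding D_def by simp_all
  have cov: "net_covers (D k) (A k)" for k
  proof (cases k)
    case 0 then show ?thesis using C(1)[of 0] D0 net_covers_maximal_nodes by simp
  next
    case (Suc i)
    have "net_covers (D i \<union> C (Suc i)) (A (Suc i))"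
      using C(1)[of "Suc i"] unfolding net_covers_def by blast
    then show ?thesis using Suc DS net_covers_maximal_nodes by simp
  qed
  have W: "?W (D k) \<le> net_content t (A k) + ennreal (\<epsilon> * (1 - 1 / 2 ^ Suc k))" for k
  proof (induction k)
    case 0
    have "?W (D 0) \<le> ?W (C 0)" unfolding D0 by (intro emeasure_mono maximal_nodes_subset) auto
    also have "\<dots> \<le> net_content t (A 0) + ennreal (\<epsilon> / 2 ^ Suc 0)" using C(2)[of 0] by simp
    finally show ?case by simp
  next
    case (Suc k)
    have pow: "(1::real) \<le> 2 * 2 ^ k" using one_le_power[of "2::real" k] by linarith
    have fin: "net_content t (A k) \<noteq> \<infinity>" using bound[of k] by (auto simp: top_unique)
    have "A k \<inter> A (Suc k) = A k" using \<open>incseq A\<close> unfolding incseq_Suc_iff by blast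
    then have "?W (D (Suc k)) + net_content t (A k) \<le> ?W (D k) + ?W (C (Suc k))"
      using net_strong_subadditivity[OF cov[of k] C(1)[of "Suc k"], of t] unfolding DS by simp
    also have "\<dots> \<le> (net_content t (A k) + ennreal (\<epsilon> * (1 - 1 / 2 ^ Suc k))) +
        (net_content t (A (Suc k)) + ennreal (\<epsilon> / 2 ^ Suc (Suc k)))"
      by (intro add_mono Suc.IH less_imp_le[OF C(2)])
    also have "\<dots> = (net_content t (A (Suc k)) +
        (ennreal (\<epsilon> * (1 - 1 / 2 ^ Suc k)) + ennreal (\<epsilon> / 2 ^ Suc (Suc k)))) + net_content t (A k)"
      by (simp add: ac_simps)
    also have "ennreal (\<epsilon> * (1 - 1 / 2 ^ Suc k)) + ennreal (\<epsilon> / 2 ^ Suc (Suc k))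
        = ennreal (\<epsilon> * (1 - 1 / 2 ^ Suc (Suc k)))"
      using \<open>\<epsilon> > 0\<close> pow by (subst ennreal_plus[symmetric]) (auto simp: field_simps)
    finally show ?case
      using fin by (metis add.commute ennreal_add_left_cancel_le infinity_ennreal_def)
  qed
  \<comment> \<open>The squares that belong to all but finitely many of the merged covers.\<close>
  define Dlim where "Dlim = (\<Union>n. \<Inter>k\<in>{n..}. D k)"
  have "net_covers Dlim (\<Union>k. A k)"
    unfolding net_covers_def
  proof
    fix x assume "x \<in> (\<Union>k. A k)"
    then obtain k0 where k0: "x \<in> A k0" by blast
    have inA: "x \<in> A k" if "k \<ge> k0" for k
      using k0 \<open>incseq A\<close> that unfolding incseq_def by blast
    \<comment> \<open>The level of the largest square of the k-th merged cover that contains x.\<close>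
    define top where "top k = (LEAST n. (n, cell n x) \<in> D k)" for k
    have top: "(top k, cell (top k) x) \<in> D k" if "k \<ge> k0" for k
    proof -
      have "\<exists>n. (n, cell n x) \<in> D k" using cov[of k] inA[OF that] unfolding net_covers_def by blast
      then show ?thesis unfolding top_def by (rule LeastI_ex)
    qed
    have step: "\<exists>m\<le>top k. (m, cell m x) \<in> D (Suc k)" if "k \<ge> k0" for k
    proof -
      let ?P = "\<lambda>n. (n, cell n x) \<in> D k \<union> C (Suc k)"
      have P: "?P (top k)" using top[OF that] by blast
      then have "?P (LEAST n. ?P n)" by (rule LeastI)
      moreover have "\<forall>m<(LEAST n. ?P n). \<not> ?P m" using not_less_Least by blast
      ultimately have "((LEAST n. ?P n), cell (LEAST n. ?P n) x) \<in> D (Suc k)"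
        unfolding DS maximal_nodes_iff by blast
      then show ?thesis using Least_le[of ?P, OF P] by blast
    qed
    have decr: "top (Suc k) \<le> top k" if "k \<ge> k0" for k
    proof -
      obtain m where "m \<le> top k" "(m, cell m x) \<in> D (Suc k)" using step[OF \<open>k \<ge> k0\<close>] by blast
      then show ?thesis unfolding top_def[of "Suc k"] by (metis (mono_tags, lifting) Least_le le_trans)
    qed
    define n where "n = (LEAST n. \<exists>k\<ge>k0. top k = n)"
    have "\<exists>k\<ge>k0. top k = n" unfolding n_def by (rule LeastI_ex) blast
    then obtain k1 where k1: "k1 \<ge> k0" "top k1 = n" by blast
    have "top k = n" if "k \<ge> k1" for k
      using that
    proof (induction k rule: dec_induct)
      case (step k)
      have "n \<le> top (Suc k)" unfolding n_def
        by (rule Least_le) (rule exI[of _ "Suc k"], use step k1 in simp)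
      then show ?case using decr[of k] step k1 by simp
    qed (use k1 in simp)
    then have "(n, cell n x) \<in> D k" if "k \<ge> k1" for k
      using top[of k] that k1 by auto
    then have "(n, cell n x) \<in> Dlim" unfolding Dlim_def by blast
    then show "\<exists>n. (n, cell n x) \<in> Dlim" ..
  qed
  then have "net_content t (\<Union>k. A k) \<le> ?W Dlim" by (rule net_content_le)
  also have "\<dots> = (SUP n. ?W (\<Inter>k\<in>{n..}. D k))"
    unfolding Dlim_def by (rule SUP_emeasure_incseq[symmetric]) (force simp: incseq_def)+
  also have "\<dots> \<le> ennreal c + ennreal \<epsilon>"
  proof (rule SUP_least)
    fix n
    have "?W (\<Inter>k\<in>{n..}. D k) \<le> ?W (D n)" by (intro emeasure_mono) auto
    also have "\<dots> \<le> net_content t (A n) + ennreal (\<epsilon> * (1 - 1 / 2 ^ Suc n))" by (rule W)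
    also have "\<dots> \<le> ennreal c + ennreal \<epsilon>"
      using \<open>\<epsilon> > 0\<close> by (intro add_mono bound ennreal_leI) (auto simp: field_simps)
    finally show "?W (\<Inter>k\<in>{n..}. D k) \<le> ennreal c + ennreal \<epsilon>" .
  qed
  finally show "net_content t (\<Union>k. A k) \<le> ennreal c + ennreal \<epsilon>" .
qed

section \<open>Compact subsets of analytic sets\<close>

lemma open_contains_cylinder:
  fixes U :: "(nat \<Rightarrow> nat) set"
  assumes "open U" "\<sigma> \<in> U"
  shows "\<exists>k. {\<tau>. \<forall>i<k. \<tau> i = \<sigma> i} \<subseteq> U"
proof -
  have "\<exists>X. \<sigma> \<in> Pi\<^sub>E UNIV X \<and> (\<forall>i. openin euclidean (X i)) \<and>
      finite {i. X i \<noteq> topspace euclidean} \<and> Pi\<^sub>E UNIV X \<subseteq> U"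
    by (rule product_topology_open_contains_basis) (use assms in \<open>simp_all add: open_fun_def\<close>)
  then obtain X where X: "\<sigma> \<in> Pi\<^sub>E UNIV X" "finite {i. X i \<noteq> UNIV}" "Pi\<^sub>E UNIV X \<subseteq> U"
    unfolding topspace_euclidean by blast
  obtain k where k: "{i. X i \<noteq> UNIV} \<subseteq> {..<k}"
    using X(2) unfolding finite_nat_iff_bounded ..
  have "\<tau> \<in> U" if "\<forall>i<k. \<tau> i = \<sigma> i" for \<tau>
  proof -
    have "\<tau> i \<in> X i" for i
      using that k X(1) by (cases "X i = UNIV") (auto simp: PiE_iff)
    then show ?thesis using X(3) by (auto simp: PiE_iff)
  qed
  then show ?thesis by blast
qed

lemma open_cylinder: "open {\<tau> :: nat \<Rightarrow> nat. \<forall>i<k. \<tau> i = \<sigma> i}"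
  using product_topology_basis'[of "{..<k}" "\<lambda>i. {\<sigma> i}" "\<lambda>i. i"]
  by (simp add: open_discrete lessThan_def)

lemma compact_nat_box: "compact {\<sigma> :: nat \<Rightarrow> nat. \<forall>i. \<sigma> i \<le> g i}"
proof -
  have "compactin (product_topology (\<lambda>_. euclidean) UNIV) (Pi\<^sub>E UNIV (\<lambda>i. {..g i}))"
    unfolding compactin_PiE by (simp add: finite_imp_compact)
  moreover have "Pi\<^sub>E UNIV (\<lambda>i. {..g i}) = {\<sigma>. \<forall>i. \<sigma> i \<le> g i}"
    by (auto simp: PiE_iff)
  ultimately show ?thesis by (simp add: euclidean_product_topology)
qed

text \<open>
Membership in the compact box is decided on finitely many cylinders, and these look at finitely many
coordinates only; the remaining coordinates of a point may be replaced by \<open>0\<close>.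
\<close>

lemma open_contains_nat_box_tube:
  fixes U :: "(nat \<Rightarrow> nat) set"
  assumes "open U" "{\<sigma>. \<forall>i. \<sigma> i \<le> g i} \<subseteq> U"
  shows "\<exists>k. {\<sigma>. \<forall>i<k. \<sigma> i \<le> g i} \<subseteq> U"
proof -
  let ?K = "{\<sigma> :: nat \<Rightarrow> nat. \<forall>i. \<sigma> i \<le> g i}"
  let ?cyl = "\<lambda>\<sigma> k. {\<tau> :: nat \<Rightarrow> nat. \<forall>i<k. \<tau> i = \<sigma> i}"
  have "\<forall>\<sigma>\<in>?K. \<exists>k. ?cyl \<sigma> k \<subseteq> U" using open_contains_cylinder assms by blast
  from bchoice[OF this] obtain k where k: "\<forall>\<sigma>\<in>?K. ?cyl \<sigma> (k \<sigma>) \<subseteq> U" ..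
  have "?K \<subseteq> (\<Union>\<sigma>\<in>?K. ?cyl \<sigma> (k \<sigma>))" by (rule subsetI, rule UN_I) auto
  then obtain S where S: "S \<subseteq> ?K" "finite S" "?K \<subseteq> (\<Union>\<sigma>\<in>S. ?cyl \<sigma> (k \<sigma>))"
    by (rule compactE_image[OF compact_nat_box open_cylinder])
  define m where "m = Max (insert 0 (k ` S))"
  have m: "k \<sigma> \<le> m" if "\<sigma> \<in> S" for \<sigma>
    unfolding m_def using S(2) that by (intro Max_ge) auto
  have "\<tau> \<in> U" if \<tau>: "\<forall>i<m. \<tau> i \<le> g i" for \<tau>
  proof -
    define \<tau>' where "\<tau>' = (\<lambda>i. if i < m then \<tau> i else 0)"
    have "\<tau>' \<in> ?K" using \<tau> unfolding \<tau>'_def by simp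
    then obtain \<sigma> where \<sigma>: "\<sigma> \<in> S" "\<tau>' \<in> ?cyl \<sigma> (k \<sigma>)" using S(3) by blast
    then have "\<tau> \<in> ?cyl \<sigma> (k \<sigma>)" using m[OF \<sigma>(1)] unfolding \<tau>'_def by auto
    then show ?thesis using k \<sigma>(1) S(1) by blast
  qed
  then show ?thesis by blast
qed

lemma emeasure_net_measure_shift:
  "emeasure (net_measure t) ((\<lambda>(n, i, j). (n, i + a, j + b)) ` C) = emeasure (net_measure t) C"
proof -
  let ?f = "\<lambda>(n, i, j). (n :: nat, i + a :: int, j + b :: int)"
  have bij: "bij_betw ?f UNIV UNIV"
    by (rule bij_betwI[where g = "\<lambda>(n, i, j). (n, i - a, j - b)"]) auto
  then have inj: "inj ?f" by (rule bij_is_inj)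
  show ?thesis
    unfolding emeasure_net_measure
    by (subst nn_integral_bij_count_space[OF bij, symmetric], intro nn_integral_cong)
       (auto simp: indicator_def inj_image_mem_iff[OF inj])
qed

text \<open>
Half-open squares are not open, which would spoil compactness arguments. Replacing each square by the
three by three block around it provides an open neighbourhood at the price of a factor \<open>9\<close>.
\<close>

lemma net_covers_open_neighbourhood:
  assumes "net_covers C A"
  shows "\<exists>U C'. open U \<and> A \<subseteq> U \<and> net_covers C' U \<and>
           emeasure (net_measure t) C' \<le> 9 * emeasure (net_measure t) C"
proof -
  define S where "S = {-1, 0, 1 :: int} \<times> {-1, 0, 1 :: int}"
  define shift where "shift s = (\<lambda>(n :: nat, i, j). (n, i + fst s, j + snd s))" for s :: "int \<times> int"
  define C' where "C' = (\<Union>s\<in>S. shift s ` C)"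
  define box :: "nat \<times> int \<times> int \<Rightarrow> (real^2) set" where
    "box = (\<lambda>(n, i, j). {x. real_of_int (i - 1) < 2 ^ n * x $ 1 \<and> 2 ^ n * x $ 1 < real_of_int (i + 2) \<and>
               real_of_int (j - 1) < 2 ^ n * x $ 2 \<and> 2 ^ n * x $ 2 < real_of_int (j + 2)})"
  have "open (box v)" for v
    unfolding box_def
    by (cases v) (auto intro!: open_Collect_conj open_Collect_less continuous_intros)
  then have 1: "open (\<Union>v\<in>C. box v)" by blast
  have 2: "A \<subseteq> (\<Union>v\<in>C. box v)"
  proof
    fix x assume "x \<in> A"
    then obtain n where n: "(n, cell n x) \<in> C" using assms unfolding net_covers_def by blast
    have "x \<in> box (n, cell n x)" unfolding box_def cell_def by simp linarith
    then show "x \<in> (\<Union>v\<in>C. box v)" using n by blast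
  qed
  have 3: "net_covers C' (\<Union>v\<in>C. box v)"
    unfolding net_covers_def
  proof
    fix x assume "x \<in> (\<Union>v\<in>C. box v)"
    then obtain n i j where v: "(n, i, j) \<in> C" "x \<in> box (n, i, j)" by auto
    define s where "s = (\<lfloor>2 ^ n * x $ 1\<rfloor> - i, \<lfloor>2 ^ n * x $ 2\<rfloor> - j)"
    have *: "\<lfloor>y\<rfloor> - k \<in> {-1, 0, 1}" if "real_of_int (k - 1) < y" "y < real_of_int (k + 2)" for y k
    proof -
      have "k - 1 \<le> \<lfloor>y\<rfloor>" "\<lfloor>y\<rfloor> < k + 2"
        using that by (auto simp: le_floor_iff floor_less_iff)
      then show ?thesis by auto
    qed
    have "s \<in> S"
      using v(2) *[of i "2 ^ n * x $ 1"] *[of j "2 ^ n * x $ 2"] unfolding s_def S_def box_def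
      by (intro SigmaI) (simp_all del: insert_iff)
    moreover have "(n, cell n x) = shift s (n, i, j)" unfolding shift_def s_def cell_def by simp
    ultimately have "(n, cell n x) \<in> C'" unfolding C'_def using v(1) by blast
    then show "\<exists>n. (n, cell n x) \<in> C'" ..
  qed
  have "emeasure (net_measure t) C' \<le> (\<Sum>s\<in>S. emeasure (net_measure t) (shift s ` C))"
    unfolding C'_def S_def by (rule emeasure_subadditive_finite) auto
  also have "\<dots> = (\<Sum>s\<in>S. emeasure (net_measure t) C)"
    unfolding shift_def emeasure_net_measure_shift ..
  also have "\<dots> = 9 * emeasure (net_measure t) C"
    unfolding S_def by simp
  finally show ?thesis using 1 2 3 by blast
qed

text \<open>
Bounding the \<open>k\<close>-th coordinate by \<open>0, 1, 2, \<dots>\<close> exhausts the set obtained from bounds on the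
earlier coordinates. By continuity of the content along increasing unions, some bound keeps the content
above \<open>c\<close>, so that bounds can be chosen one coordinate at a time without loss.
\<close>

lemma analytic_large_boxes:
  fixes f :: "(nat \<Rightarrow> nat) \<Rightarrow> real^2"
  assumes "c \<ge> 0" "ennreal c < net_content t (range f)"
  shows "\<exists>g :: nat \<Rightarrow> nat. \<forall>k. ennreal c < net_content t (f ` {\<sigma>. \<forall>i<k. \<sigma> i \<le> g i})"
proof -
  define P where "P k h \<longleftrightarrow> ennreal c < net_content t (f ` {\<sigma>. \<forall>i<k. \<sigma> i \<le> h i})"
    for k :: nat and h :: "nat \<Rightarrow> nat"
  have step: "\<exists>h'. P (Suc k) h' \<and> (\<forall>i<k. h' i = h i)" if "P k h" for h k
  proof (rule ccontr)
    assume no: "\<not> (\<exists>h'. P (Suc k) h' \<and> (\<forall>i<k. h' i = h i))"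
    define A where "A n = f ` {\<sigma>. \<forall>i<Suc k. \<sigma> i \<le> (h(k := n)) i}" for n
    have "net_content t (A n) \<le> ennreal c" for n
    proof -
      have "\<forall>i<k. (h(k := n)) i = h i" by simp
      then have "\<not> P (Suc k) (h(k := n))" using no by blast
      then show ?thesis unfolding P_def A_def by (simp add: not_less)
    qed
    moreover have "incseq A"
      unfolding A_def incseq_def by (intro allI impI image_mono) (auto simp: less_Suc_eq)
    ultimately have "net_content t (\<Union>n. A n) \<le> ennreal c"
      using net_content_increasing_union[of A t c] \<open>c \<ge> 0\<close> by blast
    moreover have "f ` {\<sigma>. \<forall>i<k. \<sigma> i \<le> h i} = (\<Union>n. A n)"
      unfolding A_def by (force simp: less_Suc_eq)
    ultimately show False using that unfolding P_def by simp
  qed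
  have "P 0 (\<lambda>_. 0)" unfolding P_def using assms by simp
  then have "\<exists>h. \<forall>k. P k (h k) \<and> (\<forall>i<k. h (Suc k) i = h k i)"
    by (intro dependent_nat_choice step exI)
  then obtain h where "\<forall>k. P k (h k) \<and> (\<forall>i<k. h (Suc k) i = h k i)" ..
  then have h: "\<And>k. P k (h k)" "\<And>k. \<forall>i<k. h (Suc k) i = h k i" by auto
  have stable: "h k i = h (Suc i) i" if "i < k" for i k
    using Suc_leI[OF that]
  proof (induction k rule: dec_induct)
    case (step k)
    then show ?case using h(2)[of k] by simp
  qed simp
  have "P k (\<lambda>i. h (Suc i) i)" for k
  proof -
    have "{\<sigma>. \<forall>i<k. \<sigma> i \<le> h (Suc i) i} = {\<sigma>. \<forall>i<k. \<sigma> i \<le> h k i}"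
      by (rule Collect_cong) (metis stable)
    then show ?thesis using h(1)[of k] unfolding P_def by simp
  qed
  then show ?thesis unfolding P_def by (intro exI[of _ "\<lambda>i. h (Suc i) i"] allI)
qed

text \<open>
Take the image of the compact box given by the bounds of the previous lemma. A cover of it with small
weight would extend to a neighbourhood, which already contains the image of a set defined by finitely
many of the bounds, and that image has large content.
\<close>

lemma analytic_has_compact_subset:
  assumes "analytic_set A" "net_content t A \<noteq> 0"
  shows "\<exists>K c. compact K \<and> K \<subseteq> A \<and> c > 0 \<and> ennreal c \<le> net_content t K"
proof -
  have "net_covers {} {}" unfolding net_covers_def by simp
  from net_content_le[OF this, of t] have "net_content t {} = 0" by simp
  then have "A \<noteq> {}" using assms(2) by blast
  then obtain f :: "(nat \<Rightarrow> nat) \<Rightarrow> real^2" where f: "continuous_on UNIV f" "A = range f"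
    using assms(1) unfolding analytic_set_def by blast
  obtain c where c: "c > 0" "ennreal c < net_content t A"
  proof -
    have "0 < net_content t A" using assms(2) by (simp add: zero_less_iff_neq_zero)
    then obtain b where b: "0 < b" "b < net_content t A" using dense by blast
    then have "b \<noteq> top" by (auto simp: less_top[symmetric] dest: less_trans order.strict_implies_not_eq)
    then show ?thesis using b that[of "enn2real b"]
      by (metis enn2real_positive_iff ennreal_enn2real less_top top.not_eq_extremum)
  qed
  obtain g :: "nat \<Rightarrow> nat" where g: "\<And>k. ennreal c < net_content t (f ` {\<sigma>. \<forall>i<k. \<sigma> i \<le> g i})"
    using analytic_large_boxes[of c t f] c f(2) by auto
  let ?B = "{\<sigma>. \<forall>i. \<sigma> i \<le> g i}"
  have "compact (f ` ?B)"
    by (intro compact_continuous_image compact_nat_box continuous_on_subset[OF f(1)]) auto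
  moreover have "ennreal (c / 9) \<le> net_content t (f ` ?B)"
  proof (rule ccontr)
    assume "\<not> ?thesis"
    then obtain C where C: "net_covers C (f ` ?B)" "emeasure (net_measure t) C < ennreal (c / 9)"
      using net_content_less_cover[of t "f ` ?B" "ennreal (c / 9)"] by (auto simp: not_le)
    obtain U C' where U: "open U" "f ` ?B \<subseteq> U" "net_covers C' U"
        "emeasure (net_measure t) C' \<le> 9 * emeasure (net_measure t) C"
      using net_covers_open_neighbourhood[OF C(1)] by blast
    have "open (f -` U)" using f(1) U(1) by (rule open_vimage[OF _ , rotated])
    moreover have "?B \<subseteq> f -` U" using U(2) by blast
    ultimately obtain k where k: "{\<sigma>. \<forall>i<k. \<sigma> i \<le> g i} \<subseteq> f -` U"
      using open_contains_nat_box_tube by blast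
    have "ennreal c < net_content t (f ` {\<sigma>. \<forall>i<k. \<sigma> i \<le> g i})" by (rule g)
    also have "\<dots> \<le> net_content t U" using k by (intro net_content_mono) blast
    also have "\<dots> \<le> emeasure (net_measure t) C'" by (rule net_content_le) (rule U)
    also have "\<dots> \<le> 9 * emeasure (net_measure t) C" by (rule U)
    also have "\<dots> \<le> ennreal 9 * ennreal (c / 9)"
      using C(2) by (auto intro!: mult_left_mono simp: less_imp_le)
    also have "\<dots> = ennreal c" using c(1) by (subst ennreal_mult[symmetric]) auto
    finally show False by simp
  qed
  ultimately show ?thesis using c(1) f(2)
    by (intro exI[of _ "f ` ?B"] exI[of _ "c / 9"]) auto
qed

lemma norm_vec2_le: "norm (x :: real^2) \<le> \<bar>x $ 1\<bar> + \<bar>x $ 2\<bar>"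
  using norm_le_l1_cart[of x] by (simp add: sum_2)

lemma cell_dist:
  assumes "cell n x = cell n y"
  shows "norm (x - y) \<le> 2 * 2 powr (- real n)"
proof -
  have *: "\<bar>a - b\<bar> \<le> 2 powr (- real n)" if "\<lfloor>2 ^ n * a\<rfloor> = \<lfloor>2 ^ n * b\<rfloor>" for a b :: real
  proof -
    have "\<bar>2 ^ n * a - 2 ^ n * b\<bar> \<le> 1" using that by linarith
    then have "2 ^ n * \<bar>a - b\<bar> \<le> 1" by (simp add: abs_mult flip: right_diff_distrib)
    then show ?thesis by (simp add: powr_minus powr_realpow field_simps)
  qed
  have "norm (x - y) \<le> \<bar>x $ 1 - y $ 1\<bar> + \<bar>x $ 2 - y $ 2\<bar>" using norm_vec2_le[of "x - y"] by simp
  also have "\<dots> \<le> 2 * 2 powr (- real n)"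
    using *[of "x $ 1" "y $ 1"] *[of "x $ 2" "y $ 2"] assms unfolding cell_def by simp
  finally show ?thesis .
qed

text \<open>
If the total weight of a cover is small, then so is the weight \<open>2^(-t n)\<close> of each single node. As
\<open>t > 0\<close>, all squares of the cover are small, so the cover is admissible for the premeasure at a
prescribed \<open>\<delta>\<close>.
\<close>

lemma hausdorff_null_if_net_null:
  assumes "t > 0" "net_content t A = 0"
  shows "hausdorff_measure t A = 0"
proof -
  have *: "hausdorff_premeasure t \<delta> A \<le> 0 + ennreal \<epsilon>" if "\<delta> > 0" "\<epsilon> > 0" for \<delta> \<epsilon> :: real
  proof -
    \<comment> \<open>The first bound controls the sum, the second one the diameters.\<close>
    define \<eta> where "\<eta> = min (\<epsilon> / 2 powr t) ((\<delta> / 2) powr t)"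
    have "\<eta> > 0" unfolding \<eta>_def using that by simp
    then obtain C where C: "net_covers C A" "emeasure (net_measure t) C < ennreal \<eta>"
      using net_content_less_cover[of t A "ennreal \<eta>"] assms(2) by auto
    have level: "2 * 2 powr (- real (fst v)) \<le> \<delta>" if "v \<in> C" for v
    proof -
      have "ennreal (2 powr (- t * real (fst v))) \<le> emeasure (net_measure t) C"
        unfolding emeasure_net_measure_singleton[symmetric] using that by (intro emeasure_mono) auto
      then have "2 powr (- t * real (fst v)) < \<eta>"
        using C(2) \<open>\<eta> > 0\<close> by (metis ennreal_less_iff order.strict_trans1 powr_ge_zero)
      then have "(2 powr (- real (fst v))) powr t \<le> (\<delta> / 2) powr t"
        unfolding \<eta>_def by (simp add: powr_powr mult.commute)
      then have "2 powr (- real (fst v)) \<le> \<delta> / 2"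
        using \<open>t > 0\<close> \<open>\<delta> > 0\<close> by (metis not_le powr_less_mono2 powr_ge_zero half_gt_zero less_imp_le)
      then show ?thesis by simp
    qed
    define U :: "nat \<Rightarrow> (real^2) set" where
      "U i = {x. \<exists>v\<in>C. i = to_nat v \<and> cell (fst v) x = snd v}" for i
    have U_to_nat: "U (to_nat v) = (if v \<in> C then {x. cell (fst v) x = snd v} else {})" for v
      unfolding U_def by auto
    have U_other: "U i = {}" if "i \<notin> range (to_nat :: nat \<times> int \<times> int \<Rightarrow> nat)" for i
      using that unfolding U_def by auto
    have diam: "bounded {x. cell n x = w}" "diameter {x. cell n x = w} \<le> 2 * 2 powr (- real n)" for n w
    proof -
      show "diameter {x. cell n x = w} \<le> 2 * 2 powr (- real n)"
        by (rule diameter_le) (auto intro: cell_dist)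
      show "bounded {x. cell n x = w}"
      proof (cases "{x. cell n x = w} = {}")
        case False
        then obtain y where "cell n y = w" by blast
        then have "{x. cell n x = w} \<subseteq> cball y (2 * 2 powr (- real n))"
          by (auto simp: dist_norm intro!: cell_dist)
        then show ?thesis using bounded_cball bounded_subset by blast
      qed simp
    qed
    have ok: "bounded (U i) \<and> diameter (U i) \<le> \<delta>" for i
    proof (cases "i \<in> range (to_nat :: nat \<times> int \<times> int \<Rightarrow> nat)")
      case True
      then obtain v :: "nat \<times> int \<times> int" where v: "i = to_nat v" by blast
      show ?thesis
      proof (cases "v \<in> C")
        case True
        then show ?thesis
          unfolding v U_to_nat by (simp add: diam(1) order_trans[OF diam(2) level[OF True]])
      qed (use that in \<open>simp add: v U_to_nat diameter_def\<close>)
    qed (use that in \<open>simp add: U_other diameter_def\<close>)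
    have cov: "A \<subseteq> (\<Union>i. U i)"
    proof
      fix x assume "x \<in> A"
      then obtain n where "(n, cell n x) \<in> C" using C(1) unfolding net_covers_def by blast
      then have "x \<in> U (to_nat (n, cell n x))" unfolding U_to_nat by simp
      then show "x \<in> (\<Union>i. U i)" by blast
    qed
    have "hausdorff_premeasure t \<delta> A \<le> (\<Sum>i. diam_pow t (U i))"
      unfolding hausdorff_premeasure_def using cov ok by (intro INF_lower) simp
    also have "\<dots> = (\<integral>\<^sup>+i. diam_pow t (U i) \<partial>count_space UNIV)"
      by (rule nn_integral_count_space_nat[symmetric])
    also have "\<dots> = (\<integral>\<^sup>+i. diam_pow t (U i) * indicator (range (to_nat :: nat \<times> int \<times> int \<Rightarrow> nat)) i \<partial>count_space UNIV)"
      by (rule nn_integral_cong) (auto simp: indicator_def U_other diam_pow_def)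
    also have "\<dots> = (\<integral>\<^sup>+i. diam_pow t (U i) \<partial>count_space (range (to_nat :: nat \<times> int \<times> int \<Rightarrow> nat)))"
      by (rule nn_integral_count_space_indicator[symmetric]) simp
    also have "\<dots> = (\<integral>\<^sup>+v. diam_pow t (U (to_nat v)) \<partial>count_space (UNIV :: (nat \<times> int \<times> int) set))"
      by (rule nn_integral_bij_count_space[symmetric]) (simp add: bij_betw_def)
    also have "\<dots> \<le> (\<integral>\<^sup>+v. ennreal (2 powr t) *
          (ennreal (2 powr (- t * real (fst v))) * indicator C v) \<partial>count_space UNIV)"
    proof (rule nn_integral_mono)
      fix v :: "nat \<times> int \<times> int"
      show "diam_pow t (U (to_nat v))
          \<le> ennreal (2 powr t) * (ennreal (2 powr (- t * real (fst v))) * indicator C v)"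
      proof (cases "U (to_nat v) = {}")
        case False
        then have v: "v \<in> C" "U (to_nat v) = {x. cell (fst v) x = snd v}"
          unfolding U_to_nat by (auto split: if_splits)
        have "diameter (U (to_nat v)) powr t \<le> (2 * 2 powr (- real (fst v))) powr t"
          unfolding v(2) using assms(1) diam by (intro powr_mono2 diameter_ge_0) auto
        also have "\<dots> = 2 powr t * 2 powr (- t * real (fst v))"
          by (simp add: powr_mult powr_powr mult.commute)
        finally show ?thesis
          using v(1) False assms(1)
          by (simp add: diam_pow_def ennreal_leI flip: ennreal_mult)
      qed (simp add: diam_pow_def)
    qed
    also have "\<dots> = ennreal (2 powr t) * emeasure (net_measure t) C"
      unfolding emeasure_net_measure by (rule nn_integral_cmult) simp
    also have "\<dots> \<le> ennreal (2 powr t) * ennreal (\<epsilon> / 2 powr t)"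
      using C(2) unfolding \<eta>_def
      by (intro mult_left_mono) (meson ennreal_leI less_imp_le min.cobounded1 order_trans, simp)
    also have "\<dots> = ennreal \<epsilon>"
      using that by (subst ennreal_mult[symmetric]) auto
    finally show ?thesis by simp
  qed
  then have "hausdorff_premeasure t \<delta> A \<le> 0" if "\<delta> > 0" for \<delta>
    by (rule ennreal_le_epsilon) (use * that in blast)
  then have "hausdorff_measure t A \<le> 0"
    unfolding hausdorff_measure_def by (intro SUP_least) simp
  then show ?thesis by simp
qed

section \<open>Frostman weights of finite resolution\<close>

definition cell_mass :: "(real^2) set \<Rightarrow> (real^2 \<Rightarrow> real) \<Rightarrow> nat \<Rightarrow> int \<times> int \<Rightarrow> real" where
  "cell_mass F m j v = sum m {x \<in> F. cell j x = v}"

definition frostman_weight :: "real \<Rightarrow> nat \<Rightarrow> (real^2) set \<Rightarrow> (real^2 \<Rightarrow> real) \<Rightarrow> bool" where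
  "frostman_weight t n F m \<longleftrightarrow>
     finite F \<and> (\<forall>x. 0 \<le> m x) \<and> (\<forall>j\<le>n. \<forall>v. cell_mass F m j v \<le> 2 powr (- t * real j))"

text \<open>
Insert the points one by one, each with the largest mass that the squares containing it permit.
Saturated squares stay saturated, and the new point lies in the square that limited its mass.
\<close>

lemma saturated_frostman_weight:
  assumes "finite F"
  shows "\<exists>m. frostman_weight t n F m \<and>
           (\<forall>x\<in>F. \<exists>j\<le>n. cell_mass F m j (cell j x) = 2 powr (- t * real j))"
  using assms
proof induction
  case empty
  show ?case by (rule exI[of _ "\<lambda>_. 0"]) (simp add: frostman_weight_def cell_mass_def)
next
  case (insert x F)
  then obtain m where m: "frostman_weight t n F m"
      "\<forall>y\<in>F. \<exists>j\<le>n. cell_mass F m j (cell j y) = 2 powr (- t * real j)" by blast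
  define slack where "slack j = 2 powr (- t * real j) - cell_mass F m j (cell j x)" for j
  define \<delta> where "\<delta> = Min (slack ` {..n})"
  have \<delta>_le: "\<delta> \<le> slack j" if "j \<le> n" for j
    unfolding \<delta>_def using that by (intro Min_le) auto
  obtain j0 where j0: "j0 \<le> n" "slack j0 = \<delta>"
  proof -
    have "\<delta> \<in> slack ` {..n}" unfolding \<delta>_def by (rule Min_in) auto
    then show ?thesis using that by auto
  qed
  have "\<delta> \<ge> 0"
    using m(1) j0 unfolding frostman_weight_def slack_def by (metis diff_ge_0_iff_ge)
  define m' where "m' = m(x := \<delta>)"
  have mass: "cell_mass (insert x F) m' j v = cell_mass F m j v + (if cell j x = v then \<delta> else 0)"
    for j v
  proof -
    have *: "sum m' {y \<in> F. cell j y = v} = sum m {y \<in> F. cell j y = v}"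
      unfolding m'_def using insert.hyps by (intro sum.cong) auto
    have "{y \<in> insert x F. cell j y = v} =
        (if cell j x = v then insert x {y \<in> F. cell j y = v} else {y \<in> F. cell j y = v})"
      by auto
    then show ?thesis
      unfolding cell_mass_def using insert.hyps * by (simp add: m'_def)
  qed
  have le: "cell_mass (insert x F) m' j v \<le> 2 powr (- t * real j)" if "j \<le> n" for j v
  proof (cases "cell j x = v")
    case True
    then show ?thesis using \<delta>_le[OF that] unfolding mass slack_def by auto
  next
    case False
    moreover have "cell_mass F m j v \<le> 2 powr (- t * real j)"
      using m(1) that unfolding frostman_weight_def by blast
    ultimately show ?thesis by (simp add: mass)
  qed
  have "frostman_weight t n (insert x F) m'"
    using m(1) insert.hyps \<open>\<delta> \<ge> 0\<close> le unfolding frostman_weight_def by (auto simp: m'_def)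
  moreover have "\<exists>j\<le>n. cell_mass (insert x F) m' j (cell j y) = 2 powr (- t * real j)"
    if "y \<in> insert x F" for y
  proof (cases "y = x")
    case True
    then show ?thesis using j0 by (intro exI[of _ j0]) (simp add: mass slack_def)
  next
    case False
    then obtain j where j: "j \<le> n" "cell_mass F m j (cell j y) = 2 powr (- t * real j)"
      using m(2) \<open>y \<in> insert x F\<close> by blast
    have "cell_mass (insert x F) m' j (cell j y) = 2 powr (- t * real j)"
      using le[OF j(1), of "cell j y"] j(2) \<open>\<delta> \<ge> 0\<close> unfolding mass by (simp split: if_splits)
    then show ?thesis using j(1) by blast
  qed
  ultimately show ?case by blast
qed

lemma finite_cell_image:
  assumes "bounded K"
  shows "finite (cell n ` K)"
proof -
  obtain B where B: "\<And>x. x \<in> K \<Longrightarrow> norm x \<le> B" using assms unfolding bounded_iff by blast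
  define N where "N = \<lceil>2 ^ n * B\<rceil> + 1"
  have "\<lfloor>2 ^ n * x $ i\<rfloor> \<in> {-N..N}" if "x \<in> K" for x i
  proof -
    have "\<bar>x $ i\<bar> \<le> B" using B[OF that] component_le_norm_cart[of x i] by simp
    then have "\<bar>2 ^ n * x $ i\<bar> \<le> 2 ^ n * B" by (simp add: abs_mult)
    then show ?thesis unfolding N_def atLeastAtMost_iff by linarith
  qed
  then have "cell n ` K \<subseteq> {-N..N} \<times> {-N..N}" unfolding cell_def by auto
  then show ?thesis by (rule finite_subset) simp
qed

text \<open>
Pick one point of \<open>K\<close> in every level-\<open>n\<close> square that meets \<open>K\<close>, and a weight for which each
point lies in a saturated square. The maximal saturated squares are disjoint and cover \<open>K\<close>, so the total
mass equals the weight of a cover of \<open>K\<close> and is at least the content. Rescaling makes the total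
equal to \<open>c\<close>.
\<close>

lemma exists_frostman_weight:
  assumes "bounded K" "c > 0" "ennreal c \<le> net_content t K"
  shows "\<exists>F m. frostman_weight t n F m \<and> F \<subseteq> K \<and> sum m F = c"
proof -
  obtain F where F: "F \<subseteq> K" "finite F" "cell n ` K = cell n ` F"
    using finite_subset_image[OF finite_cell_image[OF assms(1), of n] order_refl] by blast
  obtain m where m: "frostman_weight t n F m"
      "\<forall>x\<in>F. \<exists>j\<le>n. cell_mass F m j (cell j x) = 2 powr (- t * real j)"
    using saturated_frostman_weight[OF F(2)] by blast
  define tight where "tight x j \<longleftrightarrow> j \<le> n \<and> cell_mass F m j (cell j x) = 2 powr (- t * real j)" for x j
  have tight_coarsen: "tight x i \<longleftrightarrow> tight y i" if "cell j x = cell j y" "i \<le> j" for x y i j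
    unfolding tight_def cell_coarsen[OF that] ..
  define C where "C = (\<lambda>x. let j = (LEAST j. tight x j) in (j, cell j x)) ` F"
  have least: "tight x (LEAST j. tight x j)" if "x \<in> F" for x
    by (rule LeastI_ex) (use m(2) that in \<open>auto simp: tight_def\<close>)
  have cov: "net_covers C K"
    unfolding net_covers_def
  proof
    fix x assume "x \<in> K"
    then obtain y where y: "y \<in> F" "cell n x = cell n y" using F(3) by blast
    let ?j = "LEAST j. tight y j"
    have "?j \<le> n" using least[OF y(1)] unfolding tight_def by blast
    then have "cell ?j x = cell ?j y" using cell_coarsen[OF y(2)] by blast
    moreover have "(?j, cell ?j y) \<in> C" unfolding C_def Let_def using y(1) by blast
    ultimately show "\<exists>j. (j, cell j x) \<in> C" by metis
  qed
  have unique: "v = (let j = (LEAST j. tight y j) in (j, cell j y))"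
    if v: "v \<in> C" and y: "cell (fst v) y = snd v" for v y
  proof -
    obtain x where x: "x \<in> F" "v = ((LEAST j. tight x j), cell (LEAST j. tight x j) x)"
      using v unfolding C_def Let_def by blast
    let ?j = "LEAST j. tight x j"
    have eq: "cell ?j x = cell ?j y" using y x(2) by simp
    have "(LEAST j. tight y j) = ?j"
    proof (rule Least_equality)
      show "tight y ?j" using least[OF x(1)] tight_coarsen[OF eq] by blast
      show "?j \<le> i" if "tight y i" for i
        using that tight_coarsen[OF eq, of i] by (metis Least_le nle_le)
    qed
    then show ?thesis using x(2) eq unfolding Let_def by simp
  qed
  have disj: "{x \<in> F. cell (fst v) x = snd v} \<inter> {x \<in> F. cell (fst w) x = snd w} = {}"
    if "v \<in> C" "w \<in> C" "v \<noteq> w" for v w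
  proof (rule ccontr)
    assume "\<not> ?thesis"
    then obtain y where "cell (fst v) y = snd v" "cell (fst w) y = snd w" by blast
    then show False using unique[OF that(1)] unique[OF that(2)] that(3) by metis
  qed
  have "finite C" unfolding C_def using F(2) by simp
  have "ennreal c \<le> emeasure (net_measure t) C"
    using assms(3) net_content_le[OF cov] by (rule order_trans)
  then have "c \<le> (\<Sum>v\<in>C. 2 powr (- t * real (fst v)))"
    unfolding emeasure_net_measure_finite[OF \<open>finite C\<close>] by (simp add: sum_nonneg)
  also have "\<dots> = (\<Sum>v\<in>C. sum m {x \<in> F. cell (fst v) x = snd v})"
  proof (rule sum.cong)
    fix v assume "v \<in> C"
    then obtain x where "x \<in> F" "v = ((LEAST j. tight x j), cell (LEAST j. tight x j) x)"
      unfolding C_def Let_def by blast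
    then show "2 powr (- t * real (fst v)) = sum m {x \<in> F. cell (fst v) x = snd v}"
      using least[of x] unfolding tight_def cell_mass_def by simp
  qed simp
  also have "\<dots> = sum m (\<Union>v\<in>C. {x \<in> F. cell (fst v) x = snd v})"
    using \<open>finite C\<close> F(2) disj by (intro sum.UNION_disjoint[symmetric]) auto
  also have "\<dots> \<le> sum m F"
    using m(1) F(2) unfolding frostman_weight_def by (intro sum_mono2) auto
  finally have total: "c \<le> sum m F" .
  define r where "r = c / sum m F"
  have r: "0 \<le> r" "r \<le> 1" unfolding r_def using total assms(2) by auto
  have "cell_mass F (\<lambda>x. r * m x) j v \<le> cell_mass F m j v" for j v
    unfolding cell_mass_def using m(1) r
    by (intro sum_mono) (auto simp: frostman_weight_def mult_left_le_one_le)
  then have "\<forall>j\<le>n. \<forall>v. cell_mass F (\<lambda>x. r * m x) j v \<le> 2 powr (- t * real j)"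
    using m(1) unfolding frostman_weight_def by (blast intro: order_trans)
  then have "frostman_weight t n F (\<lambda>x. r * m x)"
    using m(1) r(1) unfolding frostman_weight_def by simp
  moreover have "(\<Sum>x\<in>F. r * m x) = c"
    unfolding sum_distrib_left[symmetric] r_def using total assms(2) by simp
  ultimately show ?thesis using F(1) by blast
qed

lemma sum_le_sum_cover:
  fixes m :: "'a \<Rightarrow> real"
  assumes "finite I" "\<And>i. i \<in> I \<Longrightarrow> finite (Y i)" "X \<subseteq> (\<Union>i\<in>I. Y i)" "\<And>x. 0 \<le> m x"
  shows "sum m X \<le> (\<Sum>i\<in>I. sum m (Y i))"
proof -
  have "sum m X \<le> sum m (\<Union>i\<in>I. Y i)" using assms by (intro sum_mono2) auto
  also have "\<dots> \<le> (\<Sum>i\<in>I. sum m (Y i))"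
    using assms(1,2)
  proof induction
    case (insert i I)
    have "sum m (Y i \<union> (\<Union>i\<in>I. Y i)) + sum m (Y i \<inter> (\<Union>i\<in>I. Y i)) = sum m (Y i) + sum m (\<Union>i\<in>I. Y i)"
      using insert by (intro sum.union_inter) auto
    moreover have "0 \<le> sum m (Y i \<inter> (\<Union>i\<in>I. Y i))" using assms(4) by (intro sum_nonneg)
    ultimately show ?case using insert by simp
  qed simp
  finally show ?thesis .
qed

text \<open>
Points whose coordinates differ by at most \<open>2^-j\<close> lie in a three by three block of level-\<open>j\<close> squares.
\<close>

lemma frostman_weight_small_set:
  assumes "frostman_weight t n F m" "Y \<subseteq> F" "j \<le> n"
    and close: "\<And>x y i. x \<in> Y \<Longrightarrow> y \<in> Y \<Longrightarrow> \<bar>x $ i - y $ i\<bar> \<le> 2 powr (- real j)"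
  shows "sum m Y \<le> 9 * 2 powr (- t * real j)"
proof (cases "Y = {}")
  case False
  then obtain x where x: "x \<in> Y" by blast
  define I where "I = (\<lambda>i. {\<lfloor>2 ^ j * x $ i\<rfloor> - 1 .. \<lfloor>2 ^ j * x $ i\<rfloor> + 1})"
  have "\<lfloor>2 ^ j * y $ i\<rfloor> \<in> I i" if "y \<in> Y" for y i
  proof -
    have "2 ^ j * \<bar>y $ i - x $ i\<bar> \<le> 1"
      using close[OF that x, of i] by (simp add: powr_minus powr_realpow field_simps)
    then have "\<bar>2 ^ j * y $ i - 2 ^ j * x $ i\<bar> \<le> 1" by (simp add: abs_mult flip: right_diff_distrib)
    then show ?thesis unfolding I_def atLeastAtMost_iff by linarith
  qed
  then have "Y \<subseteq> (\<Union>v\<in>I 1 \<times> I 2. {y \<in> F. cell j y = v})"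
    using assms(2) unfolding cell_def by auto
  then have "sum m Y \<le> (\<Sum>v\<in>I 1 \<times> I 2. cell_mass F m j v)"
    unfolding cell_mass_def using assms(1) unfolding frostman_weight_def
    by (intro sum_le_sum_cover) (auto simp: I_def)
  also have "\<dots> \<le> (\<Sum>v\<in>I 1 \<times> I 2. 2 powr (- t * real j))"
    using assms(1,3) unfolding frostman_weight_def by (intro sum_mono) auto
  also have "\<dots> = 9 * 2 powr (- t * real j)"
    by (simp add: I_def card_cartesian_product)
  finally show ?thesis .
qed simp

section \<open>Few angles are bad\<close>

definition ang_proj :: "real \<Rightarrow> real^2 \<Rightarrow> real" where
  "ang_proj \<theta> x = x $ 1 * cos \<theta> + x $ 2 * sin \<theta>"

lemma ang_proj_diff: "ang_proj \<theta> (x - y) = ang_proj \<theta> x - ang_proj \<theta> y"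
  unfolding ang_proj_def by (simp add: algebra_simps)

lemma abs_sin_ge_half:
  fixes d :: real
  assumes "\<bar>d\<bar> \<le> 1"
  shows "\<bar>d\<bar> / 2 \<le> \<bar>sin d\<bar>"
proof -
  have pos: "d / 2 \<le> sin d" if "0 \<le> d" "d \<le> 1" for d :: real
  proof -
    have "sin 0 - 0 / 2 \<le> sin d - d / 2"
    proof (rule DERIV_nonneg_imp_nondecreasing[of 0 d "\<lambda>x. sin x - x / 2", OF that(1)])
      fix x :: real assume x: "0 \<le> x" "x \<le> d"
      have "cos (pi / 3) \<le> cos x"
        using x that pi_gt3 by (intro cos_monotone_0_pi_le) auto
      then have "0 \<le> cos x - 1 / 2" by (simp add: cos_60)
      moreover have "((\<lambda>x. sin x - x / 2) has_real_derivative (cos x - 1 / 2)) (at x)"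
        by (auto intro!: derivative_eq_intros)
      ultimately show "\<exists>y. ((\<lambda>x. sin x - x / 2) has_real_derivative y) (at x) \<and> 0 \<le> y" by blast
    qed
    then show ?thesis by simp
  qed
  show ?thesis using pos[of d] pos[of "-d"] assms by (cases "0 \<le> d") auto
qed

text \<open>
Solve the two linear equations for the coordinates of \<open>x\<close>; their determinant is \<open>sin (\<theta>' - \<theta>)\<close>.
\<close>

lemma ang_proj_transversal:
  assumes "\<theta> \<noteq> \<theta>'" "\<bar>\<theta> - \<theta>'\<bar> \<le> 1" "\<bar>ang_proj \<theta> x\<bar> \<le> \<rho>" "\<bar>ang_proj \<theta>' x\<bar> \<le> \<rho>"
  shows "\<bar>x $ i\<bar> \<le> 4 * \<rho> / \<bar>\<theta> - \<theta>'\<bar>"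
proof -
  let ?d = "\<theta>' - \<theta>"
  have cs: "\<bar>a * p - b * q\<bar> \<le> 2 * \<rho>"
    if "\<bar>a\<bar> \<le> \<rho>" "\<bar>b\<bar> \<le> \<rho>" "\<bar>p\<bar> \<le> 1" "\<bar>q\<bar> \<le> 1" for a b p q :: real
  proof -
    have "\<bar>a * p\<bar> \<le> \<rho> * 1" "\<bar>b * q\<bar> \<le> \<rho> * 1"
      unfolding abs_mult using that by (intro mult_mono; simp)+
    then show ?thesis by linarith
  qed
  have 1: "x $ 1 * sin ?d = ang_proj \<theta> x * sin \<theta>' - ang_proj \<theta>' x * sin \<theta>"
    unfolding ang_proj_def sin_diff by (simp add: algebra_simps)
  have 2: "x $ 2 * sin ?d = ang_proj \<theta>' x * cos \<theta> - ang_proj \<theta> x * cos \<theta>'"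
    unfolding ang_proj_def sin_diff by (simp add: algebra_simps)
  have "\<bar>x $ 1 * sin ?d\<bar> \<le> 2 * \<rho>" "\<bar>x $ 2 * sin ?d\<bar> \<le> 2 * \<rho>"
    unfolding 1 2 using assms by (intro cs; simp)+
  then have "\<bar>x $ i\<bar> * \<bar>sin ?d\<bar> \<le> 2 * \<rho>"
    using exhaust_2[of i] by (auto simp: abs_mult)
  moreover have "\<bar>x $ i\<bar> * (\<bar>?d\<bar> / 2) \<le> \<bar>x $ i\<bar> * \<bar>sin ?d\<bar>"
    using assms(2) by (intro mult_left_mono abs_sin_ge_half) auto
  ultimately have "\<bar>x $ i\<bar> * \<bar>\<theta> - \<theta>'\<bar> \<le> 4 * \<rho>" by (simp add: abs_minus_commute)
  then show ?thesis using assms(1) by (simp add: field_simps)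
qed

definition in_tubes :: "real \<Rightarrow> nat \<Rightarrow> real \<Rightarrow> (real^2) set \<Rightarrow> bool" where
  "in_tubes u l \<theta> X \<longleftrightarrow>
     (\<exists>Z. finite Z \<and> real (card Z) \<le> 2 powr (u * real l) \<and>
        (\<forall>x\<in>X. \<exists>z\<in>Z. \<bar>ang_proj \<theta> x - z\<bar> \<le> 2 powr (- real l)))"

text \<open>
A strip of half-width \<open>2^-l\<close> for \<open>\<theta>\<close> and one for \<open>\<theta>'\<close> meet in a parallelogram that
fits into a square of side \<open>2^-(l - M - 3)\<close>. The factor \<open>2^(2 u l)\<close> counts the pairs of strips.
\<close>

lemma frostman_weight_two_tubes:
  assumes w: "frostman_weight t n F m" and "l \<le> n" "M + 3 \<le> l"
    and sep: "2 powr (- real M) \<le> \<bar>\<theta> - \<theta>'\<bar>" "\<bar>\<theta> - \<theta>'\<bar> \<le> 1"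
    and X: "X \<subseteq> F" "in_tubes u l \<theta> X" "in_tubes u l \<theta>' X'"
  shows "sum m (X \<inter> X') \<le> 2 powr (2 * u * real l) * (9 * 2 powr (- t * real (l - M - 3)))"
proof -
  let ?\<epsilon> = "2 powr (- real l)"
  obtain Z where Z: "finite Z" "real (card Z) \<le> 2 powr (u * real l)"
      "\<forall>x\<in>X. \<exists>z\<in>Z. \<bar>ang_proj \<theta> x - z\<bar> \<le> ?\<epsilon>"
    using X(2) unfolding in_tubes_def by blast
  obtain Z' where Z': "finite Z'" "real (card Z') \<le> 2 powr (u * real l)"
      "\<forall>x\<in>X'. \<exists>z\<in>Z'. \<bar>ang_proj \<theta>' x - z\<bar> \<le> ?\<epsilon>"
    using X(3) unfolding in_tubes_def by blast
  define Y where "Y p = {x \<in> F. \<bar>ang_proj \<theta> x - fst p\<bar> \<le> ?\<epsilon> \<and> \<bar>ang_proj \<theta>' x - snd p\<bar> \<le> ?\<epsilon>}" for p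
  have "finite F" and m_nonneg: "\<And>x. 0 \<le> m x" using w unfolding frostman_weight_def by auto
  have "X \<inter> X' \<subseteq> (\<Union>p\<in>Z \<times> Z'. Y p)"
    using X(1) Z(3) Z'(3) unfolding Y_def by fastforce
  then have "sum m (X \<inter> X') \<le> (\<Sum>p\<in>Z \<times> Z'. sum m (Y p))"
    using Z(1) Z'(1) \<open>finite F\<close> m_nonneg by (intro sum_le_sum_cover) (auto simp: Y_def)
  also have "\<dots> \<le> (\<Sum>p\<in>Z \<times> Z'. 9 * 2 powr (- t * real (l - M - 3)))"
  proof (rule sum_mono)
    fix p
    show "sum m (Y p) \<le> 9 * 2 powr (- t * real (l - M - 3))"
    proof (rule frostman_weight_small_set[OF w])
      fix x y i assume xy: "x \<in> Y p" "y \<in> Y p"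
      have "0 < 2 powr (- real M)" by simp
      have "\<bar>(x - y) $ i\<bar> \<le> 4 * (2 * ?\<epsilon>) / \<bar>\<theta> - \<theta>'\<bar>"
        using xy sep \<open>0 < 2 powr (- real M)\<close>
        by (intro ang_proj_transversal) (auto simp: ang_proj_diff Y_def)
      also have "\<dots> \<le> 4 * (2 * ?\<epsilon>) / 2 powr (- real M)"
        using sep by (intro divide_left_mono) (auto intro: mult_pos_pos less_le_trans[OF \<open>0 < 2 powr (- real M)\<close>])
      also have "\<dots> = 2 powr 3 * ?\<epsilon> / 2 powr (- real M)" by simp
      also have "\<dots> = 2 powr (- real (l - M - 3))"
        unfolding powr_add[symmetric] powr_diff[symmetric] using assms(3)
        by (intro arg_cong[where f = "\<lambda>s. 2 powr s"]) (simp add: of_nat_diff)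
      finally show "\<bar>x $ i - y $ i\<bar> \<le> 2 powr (- real (l - M - 3))" by simp
    qed (use assms(2) in \<open>auto simp: Y_def\<close>)
  qed
  also have "\<dots> = (real (card Z) * real (card Z')) * (9 * 2 powr (- t * real (l - M - 3)))"
    by (simp add: card_cartesian_product)
  also have "\<dots> \<le> (2 powr (u * real l) * 2 powr (u * real l)) * (9 * 2 powr (- t * real (l - M - 3)))"
    using Z(2) Z'(2) by (intro mult_right_mono mult_mono) auto
  also have "2 powr (u * real l) * 2 powr (u * real l) = 2 powr (2 * u * real l)"
    unfolding powr_add[symmetric] by (simp add: mult.assoc)
  finally show ?thesis .
qed

text \<open>
Each of the sets loses at most \<open>q \<beta>\<close> to the union of the others.
\<close>

lemma sum_union_nearly_disjoint:
  fixes m :: "'a \<Rightarrow> real"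
  assumes "finite S" "card S \<le> q" "\<And>i. i \<in> S \<Longrightarrow> finite (X i)" "\<And>x. 0 \<le> m x" "\<beta> \<ge> 0"
    and "\<And>i. i \<in> S \<Longrightarrow> \<alpha> \<le> sum m (X i)"
    and "\<And>i j. i \<in> S \<Longrightarrow> j \<in> S \<Longrightarrow> i \<noteq> j \<Longrightarrow> sum m (X i \<inter> X j) \<le> \<beta>"
  shows "real (card S) * (\<alpha> - real q * \<beta>) \<le> sum m (\<Union>i\<in>S. X i)"
  using assms(1,2,3,6,7)
proof induction
  case (insert i S)
  let ?U = "\<Union>j\<in>S. X j"
  have "sum m (X i \<inter> ?U) \<le> (\<Sum>j\<in>S. sum m (X i \<inter> X j))"
    using insert.prems insert.hyps assms(4) by (intro sum_le_sum_cover) auto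
  also have "\<dots> \<le> (\<Sum>j\<in>S. \<beta>)" using insert.prems insert.hyps by (intro sum_mono) auto
  also have "\<dots> \<le> real q * \<beta>"
    using insert.prems(1) insert.hyps assms(5) by (auto intro!: mult_right_mono)
  finally have "sum m (X i \<inter> ?U) \<le> real q * \<beta>" .
  moreover have "sum m (X i \<union> ?U) + sum m (X i \<inter> ?U) = sum m (X i) + sum m ?U"
    using insert.prems insert.hyps by (intro sum.union_inter) auto
  moreover have "real (card S) * (\<alpha> - real q * \<beta>) \<le> sum m ?U"
    using insert.prems insert.hyps by (intro insert.IH) auto
  moreover have "\<alpha> \<le> sum m (X i)" using insert.prems by simp
  ultimately show ?case using insert.hyps by (simp add: algebra_simps)
qed simp

text \<open>
The fractions \<open>1 / ((l + 1) (l + 2))\<close> are chosen since their sum over all \<open>l\<close> telescopes to \<open>1\<close>.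
\<close>

definition bad_angle :: "(real^2) set \<Rightarrow> (real^2 \<Rightarrow> real) \<Rightarrow> real \<Rightarrow> nat \<Rightarrow> real \<Rightarrow> bool" where
  "bad_angle F m u l \<theta> \<longleftrightarrow>
     (\<exists>X\<subseteq>F. in_tubes u l \<theta> X \<and> sum m F / real ((l + 1) * (l + 2)) \<le> sum m X)"

text \<open>
The quantitative form of the requirement that \<open>l\<close> be large in terms of \<open>M\<close>: even \<open>q\<close> times the mass
that two crossing families of strips can share is at most half of the mass of a heavy set, where
\<open>q = 2 (l + 1) (l + 2) + 1\<close>.
\<close>

definition scale_ok :: "real \<Rightarrow> real \<Rightarrow> real \<Rightarrow> nat \<Rightarrow> nat \<Rightarrow> bool" where
  "scale_ok t u c M l \<longleftrightarrow> M + 3 \<le> l \<and>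
     real (2 * (l + 1) * (l + 2) + 1) * (2 powr (2 * u * real l) * (9 * 2 powr (- t * real (l - M - 3))))
       \<le> c / real (2 * (l + 1) * (l + 2))"

text \<open>
If there were \<open>q = 2 (l + 1) (l + 2) + 1\<close> bad angles, then their heavy sets would each keep half of
their mass outside of the others, and the union would have mass more than \<open>c\<close>.
\<close>

lemma card_bad_angles:
  assumes w: "frostman_weight t n F m" "sum m F = c" "c > 0" and "l \<le> n" "scale_ok t u c M l"
    and B: "finite B" "\<And>\<theta>. \<theta> \<in> B \<Longrightarrow> bad_angle F m u l \<theta>"
      "\<And>\<theta> \<theta>'. \<theta> \<in> B \<Longrightarrow> \<theta>' \<in> B \<Longrightarrow> \<theta> \<noteq> \<theta>' \<Longrightarrow>
         2 powr (- real M) \<le> \<bar>\<theta> - \<theta>'\<bar> \<and> \<bar>\<theta> - \<theta>'\<bar> \<le> 1"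
  shows "card B \<le> 2 * (l + 1) * (l + 2)"
proof (rule ccontr)
  let ?q = "2 * (l + 1) * (l + 2) + 1"
  let ?\<beta> = "2 powr (2 * u * real l) * (9 * 2 powr (- t * real (l - M - 3)))"
  let ?\<alpha> = "c / real ((l + 1) * (l + 2))"
  assume "\<not> ?thesis"
  then have "?q \<le> card B" by simp
  then obtain S where S: "S \<subseteq> B" "card S = ?q" "finite S" by (rule obtain_subset_with_card_n)
  have "\<forall>\<theta>\<in>S. \<exists>X\<subseteq>F. in_tubes u l \<theta> X \<and> ?\<alpha> \<le> sum m X"
    using B(2) S(1) w(2) unfolding bad_angle_def by blast
  then obtain X where X: "\<And>\<theta>. \<theta> \<in> S \<Longrightarrow> X \<theta> \<subseteq> F" "\<And>\<theta>. \<theta> \<in> S \<Longrightarrow> in_tubes u l \<theta> (X \<theta>)"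
      "\<And>\<theta>. \<theta> \<in> S \<Longrightarrow> ?\<alpha> \<le> sum m (X \<theta>)"
    by metis
  have "finite F" and m_nonneg: "\<And>x. 0 \<le> m x" using w unfolding frostman_weight_def by auto
  have "M + 3 \<le> l" and "real ?q * ?\<beta> \<le> c / real (2 * (l + 1) * (l + 2))"
    using assms(5) unfolding scale_ok_def by blast+
  moreover have "?\<alpha> / 2 = c / real (2 * (l + 1) * (l + 2))" by (simp add: field_simps)
  ultimately have "M + 3 \<le> l" and small: "real ?q * ?\<beta> \<le> ?\<alpha> / 2" by argo+
  have "c < real ?q * (?\<alpha> / 2)"
  proof -
    have "c = real (2 * k) * (c / real k / 2)" if "k > 0" for k :: nat using that by simp
    from this[of "(l + 1) * (l + 2)"]
    have "c = real (2 * (l + 1) * (l + 2)) * (?\<alpha> / 2)" by (simp only: mult.assoc) simp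
    also have "\<dots> < real ?q * (?\<alpha> / 2)"
    proof (rule mult_strict_right_mono)
      have "0 < ?\<alpha>" using w(3) by (intro divide_pos_pos) (auto simp del: of_nat_mult)
      then show "0 < ?\<alpha> / 2" by (rule half_gt_zero)
    qed simp
    finally show ?thesis .
  qed
  also have "\<dots> \<le> real (card S) * (?\<alpha> - real ?q * ?\<beta>)"
    unfolding S(2) using small by (intro mult_left_mono) linarith+
  also have "\<dots> \<le> sum m (\<Union>\<theta>\<in>S. X \<theta>)"
  proof (rule sum_union_nearly_disjoint)
    fix \<theta> \<theta>' assume "\<theta> \<in> S" "\<theta>' \<in> S" "\<theta> \<noteq> \<theta>'"
    then show "sum m (X \<theta> \<inter> X \<theta>') \<le> ?\<beta>"
      using B(3)[of \<theta> \<theta>'] S(1) X \<open>M + 3 \<le> l\<close> \<open>l \<le> n\<close>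
      by (intro frostman_weight_two_tubes[OF w(1)]) auto
  next
    show "finite (X \<theta>)" if "\<theta> \<in> S" for \<theta>
      using X(1)[OF that] \<open>finite F\<close> by (rule finite_subset)
  qed (use S X(3) m_nonneg in simp_all)
  also have "\<dots> \<le> sum m F" using X(1) \<open>finite F\<close> m_nonneg by (intro sum_mono2) auto
  finally show False using w(2) by simp
qed

section \<open>A thin set of angles\<close>

definition digit_bound :: "nat \<Rightarrow> nat" where
  "digit_bound k = 2 ^ (10 * k + 22)"

definition digit_pos :: "nat \<Rightarrow> nat" where
  "digit_pos k = 2 ^ (k + 8)"

definition angle_sum :: "nat \<Rightarrow> (nat \<Rightarrow> nat) \<Rightarrow> real" where
  "angle_sum K a = (\<Sum>k<K. real (a k) * 2 powr (- real (digit_pos k)))"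

definition tail_bound :: "nat \<Rightarrow> real" where
  "tail_bound K = 2 powr (- (2 ^ K))"

text \<open>
Being close to a sum of the first \<open>K\<close> digits is a closed condition, and it is imposed for every \<open>K\<close>.
Stated this way the set is compact at once, and its covers of radius \<open>tail_bound K\<close> can be read off.
\<close>

definition angle_set :: "real set" where
  "angle_set = {\<theta> \<in> {0..1}. \<forall>K. \<exists>a. (\<forall>k. a k < digit_bound k) \<and> \<bar>\<theta> - angle_sum K a\<bar> \<le> tail_bound K}"

text \<open>
The extra factor \<open>2^-(k+1)\<close> makes the tail of the digit expansion a geometric series.
\<close>

lemma digit_term_le:
  assumes "d < digit_bound k" "K \<le> k"
  shows "real d * 2 powr (- real (digit_pos k)) \<le> tail_bound K / 2 ^ Suc k"
proof -
  \<comment> \<open>Digit k contributes less than 2 ^ (10 k + 22 - 2 ^ (k + 8)), and 2 ^ (k + 8) = 2 ^ k + 255 * 2 ^ k.\<close>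
  have lin: "11 * k + 23 \<le> 255 * 2 ^ k"
    by (induction k) auto
  have "(2::nat) ^ K \<le> 2 ^ k" using assms(2) by (intro power_increasing) auto
  then have "10 * k + 22 + 2 ^ K + Suc k \<le> digit_pos k"
    using lin unfolding digit_pos_def by (simp add: power_add del: power_increasing_iff)
  then have "real (10 * k + 22 + 2 ^ K + Suc k) \<le> real (digit_pos k)"
    by (rule of_nat_mono)
  then have exp: "real (10 * k + 22) - real (digit_pos k) \<le> - (2 ^ K) - real (Suc k)"
    by simp
  have "real d \<le> real (digit_bound k)" using assms(1) by simp
  also have "\<dots> = 2 powr real (10 * k + 22)"
    unfolding digit_bound_def by (subst powr_realpow) simp_all
  finally have "real d * 2 powr (- real (digit_pos k))
      \<le> 2 powr real (10 * k + 22) * 2 powr (- real (digit_pos k))"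
    by (intro mult_right_mono) auto
  also have "\<dots> = 2 powr (real (10 * k + 22) - real (digit_pos k))"
    unfolding powr_add[symmetric] by simp
  also have "\<dots> \<le> 2 powr (- (2 ^ K) - real (Suc k))"
    using exp by (intro powr_mono) auto
  also have "\<dots> = tail_bound K / 2 ^ Suc k"
    unfolding tail_bound_def powr_diff by (subst powr_realpow) simp_all
  finally show ?thesis .
qed

lemma angle_sum_tail:
  assumes "\<forall>k. a k < digit_bound k" "K \<le> L"
  shows "angle_sum K a \<le> angle_sum L a" "angle_sum L a \<le> angle_sum K a + tail_bound K"
proof -
  show "angle_sum K a \<le> angle_sum L a"
    unfolding angle_sum_def using assms(2) by (intro sum_mono2) auto
  have "angle_sum L a \<le> angle_sum K a + tail_bound K * (1 - 1 / 2 ^ L)"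
    using assms(2)
  proof (induction L rule: dec_induct)
    case base
    then show ?case by (simp add: tail_bound_def)
  next
    case (step L)
    have "angle_sum (Suc L) a \<le> angle_sum L a + tail_bound K / 2 ^ Suc L"
      unfolding angle_sum_def using digit_term_le[of "a L" L K] assms(1) step by simp
    then show ?case using step by (simp add: algebra_simps)
  qed
  also have "\<dots> \<le> angle_sum K a + tail_bound K"
    unfolding tail_bound_def by (simp add: algebra_simps)
  finally show "angle_sum L a \<le> angle_sum K a + tail_bound K" .
qed

lemma angle_sum_bounds:
  assumes "\<forall>k. a k < digit_bound k"
  shows "0 \<le> angle_sum K a" "angle_sum K a \<le> 1"
  using angle_sum_tail[OF assms, of 0 K] by (auto simp: angle_sum_def tail_bound_def)

lemma angle_sum_in_angle_set:
  assumes "\<forall>k. a k < digit_bound k"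
  shows "angle_sum L a \<in> angle_set"
proof -
  have "\<exists>b. (\<forall>k. b k < digit_bound k) \<and> \<bar>angle_sum L a - angle_sum K b\<bar> \<le> tail_bound K" for K
  proof (cases "K \<le> L")
    case True
    then show ?thesis using assms angle_sum_tail[OF assms True] by (intro exI[of _ a]) auto
  next
    case False
    define b where "b k = (if k < L then a k else 0)" for k
    have "angle_sum L a = angle_sum K b"
      unfolding angle_sum_def b_def using False by (intro sum.mono_neutral_cong_left) auto
    moreover have "\<forall>k. b k < digit_bound k" unfolding b_def using assms by (simp add: digit_bound_def)
    ultimately show ?thesis by (intro exI[of _ b]) (simp add: tail_bound_def)
  qed
  then show ?thesis using angle_sum_bounds[OF assms] unfolding angle_set_def by simp
qed

definition angle_net :: "nat \<Rightarrow> real set" where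
  "angle_net K = angle_sum K ` (\<Pi>\<^sub>E k\<in>{..<K}. {..<digit_bound k})"

lemma finite_angle_net: "finite (angle_net K)"
  unfolding angle_net_def by (intro finite_imageI finite_PiE) auto

lemma card_angle_net: "card (angle_net K) \<le> 2 ^ (22 * K\<^sup>2)"
proof -
  have "card (angle_net K) \<le> card (\<Pi>\<^sub>E k\<in>{..<K}. {..<digit_bound k})"
    unfolding angle_net_def by (intro card_image_le finite_PiE) auto
  also have "\<dots> = 2 ^ (\<Sum>k<K. 10 * k + 22)"
    by (simp add: card_PiE digit_bound_def power_sum)
  also have "\<dots> \<le> 2 ^ (22 * K\<^sup>2)"
  proof (rule power_increasing)
    show "(\<Sum>k<K. 10 * k + 22) \<le> 22 * K\<^sup>2"
      by (induction K) (auto simp: power2_eq_square)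
  qed simp
  finally show ?thesis .
qed

lemma angle_set_eq:
  "angle_set = {0..1} \<inter> (\<Inter>K. \<Union>p\<in>angle_net K. cball p (tail_bound K))"
proof -
  have "angle_sum K a \<in> angle_net K" if "\<forall>k. a k < digit_bound k" for K a
  proof -
    have "angle_sum K a = angle_sum K (restrict a {..<K})" unfolding angle_sum_def by simp
    moreover have "restrict a {..<K} \<in> (\<Pi>\<^sub>E k\<in>{..<K}. {..<digit_bound k})" using that by auto
    ultimately show ?thesis unfolding angle_net_def by blast
  qed
  moreover have "\<exists>a. (\<forall>k. a k < digit_bound k) \<and> p = angle_sum K a" if p: "p \<in> angle_net K" for p K
  proof -
    obtain a where a: "p = angle_sum K a" "a \<in> (\<Pi>\<^sub>E k\<in>{..<K}. {..<digit_bound k})"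
      using p unfolding angle_net_def by (rule imageE)
    define b where "b k = (if k < K then a k else 0)" for k
    have "p = angle_sum K b" unfolding a(1) angle_sum_def b_def by simp
    moreover have "\<forall>k. b k < digit_bound k"
      unfolding b_def using PiE_mem[OF a(2)] by (auto simp: digit_bound_def)
    ultimately show ?thesis by blast
  qed
  ultimately have "(\<exists>a. (\<forall>k. a k < digit_bound k) \<and> \<bar>\<theta> - angle_sum K a\<bar> \<le> tail_bound K)
      \<longleftrightarrow> (\<exists>p\<in>angle_net K. \<theta> \<in> cball p (tail_bound K))" for \<theta> K
    by (metis dist_commute dist_real_def mem_cball)
  then show ?thesis unfolding angle_set_def by auto
qed

lemma compact_angle_set: "compact angle_set"
  unfolding angle_set_eq
  by (intro compact_Int_closed closed_INT ballI closed_UN finite_angle_net) auto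

text \<open>
The index of the digit that serves the scale \<open>l\<close>: the number \<open>k\<close> with \<open>4^k \<le> l < 4^(k+1)\<close>.
\<close>

definition scale_block :: "nat \<Rightarrow> nat" where
  "scale_block l = nat \<lfloor>log 4 (real l)\<rfloor>"

lemma scale_block:
  assumes "l \<ge> 1"
  shows "4 ^ scale_block l \<le> l" "l < 4 ^ Suc (scale_block l)"
proof -
  have nonneg: "0 \<le> log 4 (real l)" using assms by simp
  have "real (scale_block l) \<le> log 4 (real l)" "log 4 (real l) < real (scale_block l) + 1"
    unfolding scale_block_def using nonneg by (auto simp: of_nat_nat)
  then have "4 powr real (scale_block l) \<le> real l" "real l < 4 powr (real (Suc (scale_block l)))"
    using assms by (simp_all add: le_log_iff log_less_iff add.commute)
  then have "real (4 ^ scale_block l) \<le> real l" "real l < real (4 ^ Suc (scale_block l))"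
    by (simp_all add: powr_realpow del: power_Suc flip: powr_realpow)
  then show "4 ^ scale_block l \<le> l" "l < 4 ^ Suc (scale_block l)"
    unfolding of_nat_le_iff of_nat_less_iff by blast+
qed

lemma digit_pos_scale_block_le:
  assumes "l \<ge> 1"
  shows "real (digit_pos (scale_block l)) \<le> 256 * sqrt (real l)"
proof -
  have "((2::real) ^ scale_block l)\<^sup>2 = real (4 ^ scale_block l)"
    by (simp add: power2_eq_square flip: power_mult_distrib)
  also have "\<dots> \<le> real l" using scale_block(1)[OF assms] by (rule of_nat_mono)
  finally have "(2::real) ^ scale_block l \<le> sqrt (real l)" by (rule real_le_rsqrt)
  then show ?thesis unfolding digit_pos_def by (simp add: power_add)
qed

text \<open>
The digit position is \<open>O(sqrt l)\<close>, so the exponent \<open>2 u l - t (l - M - 3)\<close> behaves like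
\<open>- (t - 2 u) l\<close> and beats every polynomial in \<open>l\<close>.
\<close>

lemma eventually_scale_ok:
  assumes "t > 0" "2 * u < t" "c > 0"
  shows "\<forall>\<^sub>F l in sequentially. scale_ok t u c (digit_pos (scale_block l)) l"
proof -
  define d where "d = t - 2 * u"
  have "d > 0" unfolding d_def using assms(2) by simp
  have "((\<lambda>l :: nat. 18 * (2 * (real l + 1) * (real l + 2) + 1) * ((real l + 1) * (real l + 2)) *
      2 powr (- d * real l + 256 * t * sqrt (real l) + 3 * t)) \<longlongrightarrow> 0) sequentially"
    using \<open>d > 0\<close> assms(1) by real_asymp
  then have 1: "\<forall>\<^sub>F l in sequentially. 18 * (2 * (real l + 1) * (real l + 2) + 1) *
      ((real l + 1) * (real l + 2)) * 2 powr (- d * real l + 256 * t * sqrt (real l) + 3 * t) < c"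
    using assms(3) by (rule order_tendstoD)
  have 2: "\<forall>\<^sub>F l :: nat in sequentially. 256 * sqrt (real l) + 3 \<le> real l"
    by real_asymp
  show ?thesis
    using 1 2 eventually_ge_at_top[of 1]
  proof eventually_elim
    case (elim l)
    define M where "M = digit_pos (scale_block l)"
    have M: "real M \<le> 256 * sqrt (real l)"
      unfolding M_def using elim(3) by (rule digit_pos_scale_block_le)
    then have "real (M + 3) \<le> real l" using elim(2) by simp
    then have Ml: "M + 3 \<le> l" unfolding of_nat_le_iff .
    have "2 powr (2 * u * real l) * 2 powr (- t * real (l - M - 3))
        = 2 powr (- d * real l + t * real M + 3 * t)"
      unfolding powr_add[symmetric] d_def using Ml
      by (intro arg_cong[where f = "\<lambda>s. 2 powr s"]) (simp add: of_nat_diff algebra_simps)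
    also have "\<dots> \<le> 2 powr (- d * real l + 256 * t * sqrt (real l) + 3 * t)"
      using mult_left_mono[OF M, of t] assms(1) by (intro powr_mono) (auto simp: algebra_simps)
    finally have pow: "2 powr (2 * u * real l) * 2 powr (- t * real (l - M - 3))
        \<le> 2 powr (- d * real l + 256 * t * sqrt (real l) + 3 * t)" (is "?P \<le> ?Q") .
    define p where "p = (real l + 1) * (real l + 2)"
    have "p > 0" unfolding p_def by simp
    have "(2 * p + 1) * (2 powr (2 * u * real l) * (9 * 2 powr (- t * real (l - M - 3))))
        = 9 * (2 * p + 1) * ?P" by simp
    also have "\<dots> \<le> 9 * (2 * p + 1) * ?Q"
      using pow \<open>p > 0\<close> by (intro mult_left_mono) auto
    also have "\<dots> \<le> c / (2 * p)"
    proof -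
      have e: "2 * (real l + 1) * (real l + 2) = 2 * p" unfolding p_def by simp
      have "18 * (2 * p + 1) * p * ?Q < c" using elim(1) unfolding e p_def[symmetric] .
      then show ?thesis using \<open>p > 0\<close> by (simp add: field_simps)
    qed
    finally have *: "(2 * p + 1) * (2 powr (2 * u * real l) * (9 * 2 powr (- t * real (l - M - 3))))
        \<le> c / (2 * p)" .
    have nat_p: "real (2 * (l + 1) * (l + 2)) = 2 * p" "real (2 * (l + 1) * (l + 2) + 1) = 2 * p + 1"
      unfolding p_def by (simp_all add: algebra_simps)
    show ?case
      unfolding scale_ok_def nat_p M_def[symmetric] using * Ml by blast
  qed
qed

text \<open>
Exchanging the \<open>k\<close>-th entry of \<open>b \<in> B\<close> with a value \<open>d \<in> D k\<close> maps \<open>B \<times> D k\<close> injectively into the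
set of pairs \<open>(a, d')\<close> for which replacing the \<open>k\<close>-th entry of \<open>a\<close> by \<open>d'\<close> leads into \<open>B\<close>.
\<close>

lemma card_PiE_fibre_bound:
  assumes "finite I" "k \<in> I" "\<And>i. i \<in> I \<Longrightarrow> finite (D i)" "B \<subseteq> PiE I D"
    and fibre: "\<And>a. a \<in> PiE I D \<Longrightarrow> card {d \<in> D k. a(k := d) \<in> B} \<le> q"
  shows "card B * card (D k) \<le> q * card (PiE I D)"
proof -
  let ?A = "PiE I D"
  have fin: "finite ?A" using assms(1,3) by (rule finite_PiE)
  let ?S = "SIGMA a:?A. {d \<in> D k. a(k := d) \<in> B}"
  have upd: "a(k := d) \<in> ?A" if "a \<in> ?A" "d \<in> D k" for a d
    using that assms(2) by (auto simp: PiE_iff extensional_def)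
  have "card B * card (D k) = card (B \<times> D k)" by (simp add: card_cartesian_product)
  also have "\<dots> \<le> card ?S"
  proof (rule card_inj_on_le[where f = "\<lambda>(b, d). (b(k := d), b k)"])
    show "inj_on (\<lambda>(b, d). (b(k := d), b k)) (B \<times> D k)"
    proof (rule inj_onI, clarify)
      fix b d b' d' assume eq: "b(k := d) = b'(k := d')" "b k = b' k"
      have "d = d'" using fun_cong[OF eq(1), of k] by simp
      moreover have "b x = b' x" for x using fun_cong[OF eq(1), of x] eq(2) by (cases "x = k") auto
      ultimately show "b = b' \<and> d = d'" by auto
    qed
    show "(\<lambda>(b, d). (b(k := d), b k)) ` (B \<times> D k) \<subseteq> ?S"
    proof (rule image_subsetI)
      fix p assume "p \<in> B \<times> D k"
      then obtain b d where bd: "p = (b, d)" "b \<in> B" "d \<in> D k" by blast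
      then have "b \<in> ?A" using assms(4) by blast
      then show "(case p of (b, d) \<Rightarrow> (b(k := d), b k)) \<in> ?S"
        using upd[OF _ bd(3)] PiE_mem[OF _ assms(2)] bd by simp
    qed
    show "finite ?S" using fin assms(2,3) by auto
  qed
  also have "\<dots> = (\<Sum>a\<in>?A. card {d \<in> D k. a(k := d) \<in> B})"
    using fin assms(2,3) by (intro card_SigmaI) auto
  also have "\<dots> \<le> (\<Sum>a\<in>?A. q)" using fibre by (rule sum_mono)
  finally show ?thesis by (simp add: mult.commute)
qed

lemma angle_sum_update:
  assumes "k < L"
  shows "angle_sum L (a(k := d)) - angle_sum L (a(k := d'))
           = (real d - real d') * 2 powr (- real (digit_pos k))"
proof -
  have "angle_sum L (a(k := d)) = real d * 2 powr (- real (digit_pos k)) +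
      (\<Sum>i\<in>{..<L} - {k}. real (a i) * 2 powr (- real (digit_pos i)))" for d
    unfolding angle_sum_def using assms by (subst sum.remove[of _ k]) auto
  then show ?thesis by (simp add: algebra_simps)
qed

lemma sum_telescope_inverse: "(\<Sum>l\<le>n. 1 / (real (l + 1) * real (l + 2))) = 1 - 1 / real (n + 2)"
proof (induction n)
  case (Suc n)
  show ?case unfolding sum.atMost_Suc Suc.IH by (simp add: divide_simps) (simp add: algebra_simps)
qed simp

text \<open>
With all digits but the one of index \<open>scale_block l\<close> fixed, the angles are separated by the
weight of that digit, so at most \<open>2 (l + 1) (l + 2)\<close> of its values are bad. The number of values is at
least \<open>4 (l + 2)^5\<close>. One of the factors \<open>l + 1\<close> in the bound pays for the number of weights that are
considered at scale \<open>l\<close>, the rest for the sum over the scales.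
\<close>

lemma card_bad_digits:
  assumes w: "frostman_weight t n F m" "sum m F = c" "c > 0"
    and l: "1 \<le> l" "l \<le> n" "scale_ok t u c (digit_pos (scale_block l)) l" "scale_block l < L"
  defines "A \<equiv> (\<Pi>\<^sub>E k\<in>{..<L}. {..<digit_bound k})"
  shows "real (card {a \<in> A. bad_angle F m u l (angle_sum L a)})
           \<le> 1 / (2 * (real l + 1) * (real l + 1) * (real l + 2)) * real (card A)"
proof -
  define k where "k = scale_block l"
  let ?B = "{a \<in> A. bad_angle F m u l (angle_sum L a)}"
  let ?q = "2 * (l + 1) * (l + 2)"
  have zero_ext: "\<forall>i. (if i < L then a i else 0) < digit_bound i" if "a \<in> A" for a
    using that unfolding A_def by (auto simp: PiE_iff digit_bound_def)
  have bounds: "0 \<le> angle_sum L a \<and> angle_sum L a \<le> 1" if "a \<in> A" for a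
  proof -
    have "angle_sum L a = angle_sum L (\<lambda>i. if i < L then a i else 0)"
      unfolding angle_sum_def by simp
    then show ?thesis using angle_sum_bounds[OF zero_ext[OF that], of L] by simp
  qed
  have "card ?B * card {..<digit_bound k} \<le> ?q * card A"
    unfolding A_def
  proof (rule card_PiE_fibre_bound)
    fix a assume "a \<in> (\<Pi>\<^sub>E k\<in>{..<L}. {..<digit_bound k})"
    then have upd: "a(k := d) \<in> A" if "d < digit_bound k" for d
      using that l(4) unfolding A_def k_def by (auto simp: PiE_iff extensional_def)
    define S where "S = {d \<in> {..<digit_bound k}. a(k := d) \<in> ?B}"
    define \<theta> where "\<theta> d = angle_sum L (a(k := d))" for d
    have diff: "\<bar>\<theta> d - \<theta> d'\<bar> = \<bar>real d - real d'\<bar> * 2 powr (- real (digit_pos k))" for d d'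
      unfolding \<theta>_def using angle_sum_update[of k L a d d'] l(4) unfolding k_def by (simp add: abs_mult)
    have sep: "2 powr (- real (digit_pos k)) \<le> \<bar>\<theta> d - \<theta> d'\<bar>" if "d \<noteq> d'" for d d'
    proof -
      have "1 \<le> \<bar>real d - real d'\<bar>" using that by linarith
      then show ?thesis unfolding diff by (simp add: mult_le_cancel_right1)
    qed
    have inj: "inj_on \<theta> S"
    proof (rule inj_onI, rule ccontr)
      fix d d' assume "\<theta> d = \<theta> d'" "d \<noteq> d'"
      then show False using sep[of d d'] by (simp add: not_le)
    qed
    have "card (\<theta> ` S) \<le> ?q"
    proof (rule card_bad_angles[OF w l(2) l(3)])
      show "finite (\<theta> ` S)" unfolding S_def by simp
      show "bad_angle F m u l \<phi>" if "\<phi> \<in> \<theta> ` S" for \<phi>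
        using that unfolding S_def \<theta>_def by auto
      fix \<phi> \<phi>' assume \<phi>: "\<phi> \<in> \<theta> ` S" "\<phi>' \<in> \<theta> ` S" "\<phi> \<noteq> \<phi>'"
      then obtain d d' where d: "d \<in> S" "d' \<in> S" "\<phi> = \<theta> d" "\<phi>' = \<theta> d'" by blast
      have "0 \<le> \<phi>" "\<phi> \<le> 1" "0 \<le> \<phi>'" "\<phi>' \<le> 1"
        using d bounds[OF upd, of d] bounds[OF upd, of d'] unfolding S_def \<theta>_def by auto
      then show "2 powr (- real (digit_pos (scale_block l))) \<le> \<bar>\<phi> - \<phi>'\<bar> \<and> \<bar>\<phi> - \<phi>'\<bar> \<le> 1"
        using sep[of d d'] \<phi>(3) d unfolding k_def by auto
    qed
    then show "card {d \<in> {..<digit_bound k}.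
        a(k := d) \<in> {a \<in> \<Pi>\<^sub>E k\<in>{..<L}. {..<digit_bound k}. bad_angle F m u l (angle_sum L a)}} \<le> ?q"
      using card_image[OF inj] unfolding S_def A_def by simp
  qed (use l(4) in \<open>auto simp: k_def\<close>)
  then have "real (card ?B) * real (digit_bound k) \<le> real ?q * real (card A)"
    unfolding of_nat_mult[symmetric] by (subst of_nat_le_iff) simp
  moreover have "4 * (real l + 2) ^ 5 \<le> real (digit_bound k)"
  proof -
    have "l + 2 \<le> 4 ^ (k + 2)"
    proof -
      have "(1::nat) \<le> 4 ^ k" by simp
      then show ?thesis using scale_block(2)[OF l(1)] unfolding k_def by simp
    qed
    then have "(l + 2) ^ 5 \<le> (4 ^ (k + 2)) ^ 5" by (rule power_mono) simp
    moreover have "digit_bound k = 4 * (4 ^ (k + 2)) ^ 5"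
    proof -
      have "(4::nat) = 2 ^ 2" by simp
      then have "4 * (4 ^ (k + 2)) ^ 5 = (2::nat) ^ (2 + 2 * (k + 2) * 5)"
        by (metis power_add power_mult)
      then show ?thesis unfolding digit_bound_def by (simp add: algebra_simps)
    qed
    ultimately have "4 * (l + 2) ^ 5 \<le> digit_bound k" by simp
    then have "real (4 * (l + 2) ^ 5) \<le> real (digit_bound k)" by (rule of_nat_mono)
    then show ?thesis by (simp add: add.commute)
  qed
  ultimately have "real (card ?B) * (4 * (real l + 2) ^ 5) \<le> real ?q * real (card A)"
    by (meson mult_left_mono of_nat_0_le_iff order_trans)
  then have 1: "real (card ?B) \<le> real ?q / (4 * (real l + 2) ^ 5) * real (card A)"
    by (simp add: field_simps)
  have "real ?q / (4 * (real l + 2) ^ 5) \<le> 1 / (2 * (real l + 1) * (real l + 1) * (real l + 2))"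
  proof -
    define x y where "x = real l + 1" and "y = real l + 2"
    have xy: "0 < x" "x \<le> y" unfolding x_def y_def by auto
    have "real ?q = 2 * x * y" unfolding x_def y_def by (simp add: algebra_simps)
    moreover have "(2 * x * y) * (2 * x * x * y) \<le> 4 * y ^ 5"
    proof -
      have "x * x * x \<le> y * y * y" using xy by (intro mult_mono) auto
      then have "(x * x * x) * (4 * (y * y)) \<le> (y * y * y) * (4 * (y * y))"
        by (intro mult_right_mono) auto
      then show ?thesis by (simp add: power_numeral_reduce ac_simps)
    qed
    ultimately show ?thesis
      using xy unfolding x_def[symmetric] y_def[symmetric] by (simp add: divide_simps)
  qed
  then have "real ?q / (4 * (real l + 2) ^ 5) * real (card A)
      \<le> 1 / (2 * (real l + 1) * (real l + 1) * (real l + 2)) * real (card A)"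
    by (intro mult_right_mono) auto
  then show ?thesis using 1 by linarith
qed

text \<open>
The sequence \<open>l0\<close> postpones the \<open>j\<close>-th weight to scales \<open>l \<ge> l0 j \<ge> j\<close>, so at scale \<open>l\<close> at
most \<open>l + 1\<close> weights matter and the proportions of bad digit sequences have sum at most \<open>1/2\<close>.
\<close>

lemma exists_good_angle:
  assumes w: "\<And>j. frostman_weight (t j) n (F j) (m j)" "\<And>j. sum (m j) (F j) = c j" "\<And>j. c j > 0"
    and l0: "\<And>j. j \<le> l0 j" "\<And>j. 1 \<le> l0 j"
      "\<And>j l. l0 j \<le> l \<Longrightarrow> scale_ok (t j) (u j) (c j) (digit_pos (scale_block l)) l"
  shows "\<exists>\<theta>\<in>angle_set. \<forall>j l. l0 j \<le> l \<longrightarrow> l \<le> n \<longrightarrow> \<not> bad_angle (F j) (m j) (u j) l \<theta>"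
proof -
  \<comment> \<open>Digits beyond those that serve the scales up to n may be set to 0.\<close>
  define L where "L = Suc (Max (scale_block ` {..n}))"
  have L: "scale_block l < L" if "l \<le> n" for l
    unfolding L_def using that by (simp add: less_Suc_eq_le)
  define A where "A = (\<Pi>\<^sub>E k\<in>{..<L}. {..<digit_bound k})"
  have "finite A" unfolding A_def by (intro finite_PiE) auto
  have "restrict (\<lambda>_. 0) {..<L} \<in> A" unfolding A_def by (auto simp: digit_bound_def)
  then have "A \<noteq> {}" by blast
  define B where "B l j = {a \<in> A. bad_angle (F j) (m j) (u j) l (angle_sum L a)}" for l j
  define J where "J l = {j. l0 j \<le> l}" for l
  have J: "J l \<subseteq> {..l}" for l unfolding J_def using l0(1) order_trans by blast
  then have finJ: "finite (J l)" and cardJ: "card (J l) \<le> l + 1" for l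
    using finite_subset[OF J[of l]] card_mono[OF _ J[of l]] by auto
  have "real (card (\<Union>l\<le>n. \<Union>j\<in>J l. B l j)) \<le> real (\<Sum>l\<le>n. \<Sum>j\<in>J l. card (B l j))"
    unfolding of_nat_le_iff
    by (intro order_trans[OF card_UN_le] sum_mono card_UN_le finJ) auto
  also have "\<dots> = (\<Sum>l\<le>n. \<Sum>j\<in>J l. real (card (B l j)))" by simp
  also have "\<dots> \<le> (\<Sum>l\<le>n. \<Sum>j\<in>J l. 1 / (2 * (real l + 1) * (real l + 1) * (real l + 2)) * real (card A))"
  proof (intro sum_mono)
    fix l j assume "l \<in> {..n}" "j \<in> J l"
    then show "real (card (B l j)) \<le> 1 / (2 * (real l + 1) * (real l + 1) * (real l + 2)) * real (card A)"
      unfolding B_def A_def using l0 L order_trans[OF l0(2)[of j], of l]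
      by (intro card_bad_digits[OF w]) (auto simp: J_def)
  qed
  also have "\<dots> \<le> (\<Sum>l\<le>n. 1 / (real (l + 1) * real (l + 2)) * (real (card A) / 2))"
  proof (rule sum_mono)
    fix l
    let ?r = "1 / (2 * (real l + 1) * (real l + 1) * (real l + 2)) * real (card A)"
    have "(\<Sum>j\<in>J l. ?r) = real (card (J l)) * ?r" by simp
    also have "\<dots> \<le> (real l + 1) * ?r"
      using cardJ[of l] by (intro mult_right_mono) auto
    also have "\<dots> = 1 / (real (l + 1) * real (l + 2)) * (real (card A) / 2)"
      by (simp add: divide_simps) (simp add: algebra_simps)
    finally show "(\<Sum>j\<in>J l. ?r) \<le> 1 / (real (l + 1) * real (l + 2)) * (real (card A) / 2)" .
  qed
  also have "\<dots> = (1 - 1 / real (n + 2)) * (real (card A) / 2)"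
    unfolding sum_distrib_right[symmetric] sum_telescope_inverse ..
  also have "\<dots> \<le> 1 * (real (card A) / 2)" by (intro mult_right_mono) auto
  also have "\<dots> < real (card A)" using \<open>finite A\<close> \<open>A \<noteq> {}\<close> by (simp add: card_gt_0_iff)
  finally have "card (\<Union>l\<le>n. \<Union>j\<in>J l. B l j) < card A" by simp
  moreover have "(\<Union>l\<le>n. \<Union>j\<in>J l. B l j) \<subseteq> A" unfolding B_def by blast
  ultimately have "(\<Union>l\<le>n. \<Union>j\<in>J l. B l j) \<subset> A" by (metis less_irrefl psubsetI)
  then obtain a where a: "a \<in> A" "a \<notin> (\<Union>l\<le>n. \<Union>j\<in>J l. B l j)" by blast
  define b where "b i = (if i < L then a i else 0)" for i
  have "angle_sum L a = angle_sum L b" unfolding angle_sum_def b_def by simp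
  moreover have "\<forall>i. b i < digit_bound i"
    using a(1) unfolding b_def A_def by (auto simp: PiE_iff digit_bound_def)
  ultimately have "angle_sum L a \<in> angle_set" using angle_sum_in_angle_set by simp
  then show ?thesis using a unfolding B_def J_def by auto
qed

section \<open>The box dimension of the directions\<close>

lemma cos_sin_lipschitz:
  fixes a b :: real
  shows "\<bar>cos a - cos b\<bar> \<le> \<bar>a - b\<bar>" "\<bar>sin a - sin b\<bar> \<le> \<bar>a - b\<bar>"
proof -
  have *: "2 * (\<bar>y\<bar> * \<bar>sin ((a - b) / 2)\<bar>) \<le> \<bar>a - b\<bar>" if "\<bar>y\<bar> \<le> 1" for y :: real
  proof -
    have "\<bar>y\<bar> * \<bar>sin ((a - b) / 2)\<bar> \<le> 1 * \<bar>(a - b) / 2\<bar>"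
      using that by (intro mult_mono abs_sin_x_le_abs_x) auto
    then show ?thesis by simp
  qed
  have "\<bar>sin ((b - a) / 2)\<bar> = \<bar>sin ((a - b) / 2)\<bar>"
  proof -
    have "(b - a) / 2 = - ((a - b) / 2)" by (simp only: minus_divide_left minus_diff_eq)
    then show ?thesis by (simp only: sin_minus abs_minus_cancel)
  qed
  then show "\<bar>cos a - cos b\<bar> \<le> \<bar>a - b\<bar>"
    unfolding cos_diff_cos using *[of "sin ((a + b) / 2)"] by (simp add: abs_mult)
  show "\<bar>sin a - sin b\<bar> \<le> \<bar>a - b\<bar>"
    unfolding sin_diff_sin using *[of "cos ((a + b) / 2)"] by (simp add: abs_mult ac_simps)
qed

lemma ang_proj_lipschitz:
  "\<bar>ang_proj \<theta> x - ang_proj \<theta>' x\<bar> \<le> 2 * norm x * \<bar>\<theta> - \<theta>'\<bar>"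
proof -
  have "ang_proj \<theta> x - ang_proj \<theta>' x = x $ 1 * (cos \<theta> - cos \<theta>') + x $ 2 * (sin \<theta> - sin \<theta>')"
    unfolding ang_proj_def by (simp add: algebra_simps)
  also have "\<bar>\<dots>\<bar> \<le> \<bar>x $ 1\<bar> * \<bar>cos \<theta> - cos \<theta>'\<bar> + \<bar>x $ 2\<bar> * \<bar>sin \<theta> - sin \<theta>'\<bar>"
    by (rule order_trans[OF abs_triangle_ineq]) (simp add: abs_mult)
  also have "\<dots> \<le> norm x * \<bar>\<theta> - \<theta>'\<bar> + norm x * \<bar>\<theta> - \<theta>'\<bar>"
    by (intro add_mono mult_mono component_le_norm_cart cos_sin_lipschitz) auto
  finally show ?thesis by simp
qed

definition direction :: "real \<Rightarrow> real^2" where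
  "direction \<theta> = vector [cos \<theta>, sin \<theta>]"

lemma dir_proj_direction: "dir_proj (direction \<theta>) = ang_proj \<theta>"
  unfolding dir_proj_def ang_proj_def direction_def
  by (rule ext) (simp add: inner_vec_def sum_2 mult.commute)

lemma direction_in_sphere: "direction \<theta> \<in> sphere 0 1"
  unfolding direction_def by (simp add: norm_eq_1 inner_vec_def sum_2 flip: power2_eq_square)

lemma direction_lipschitz: "norm (direction \<theta> - direction \<theta>') \<le> 2 * \<bar>\<theta> - \<theta>'\<bar>"
  using norm_vec2_le[of "direction \<theta> - direction \<theta>'"] cos_sin_lipschitz[of \<theta> \<theta>']
  unfolding direction_def by simp

lemma covering_number_le:
  assumes "finite \<U>" "A \<subseteq> \<Union>\<U>" "\<And>U. U \<in> \<U> \<Longrightarrow> bounded U \<and> diameter U \<le> \<delta>"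
  shows "covering_number \<delta> A \<le> card \<U>"
  unfolding covering_number_def by (rule Least_le) (use assms in blast)

lemma covering_number_directions:
  "covering_number (4 * tail_bound K) (direction ` angle_set) \<le> 2 ^ (22 * K\<^sup>2)"
proof -
  define U where "U p = direction ` (cball p (tail_bound K))" for p
  have "bounded (U p) \<and> diameter (U p) \<le> 4 * tail_bound K" for p
  proof -
    have "tail_bound K \<ge> 0" unfolding tail_bound_def by simp
    have close: "norm (x - y) \<le> 4 * tail_bound K" if xy: "x \<in> U p" "y \<in> U p" for x y
    proof -
      obtain a b where ab: "x = direction a" "y = direction b"
          "\<bar>p - a\<bar> \<le> tail_bound K" "\<bar>p - b\<bar> \<le> tail_bound K"
        using xy unfolding U_def by (auto simp: dist_real_def)
      have "norm (x - y) \<le> 2 * \<bar>a - b\<bar>" unfolding ab by (rule direction_lipschitz)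
      also have "\<bar>a - b\<bar> \<le> tail_bound K + tail_bound K"
        using abs_triangle_ineq4[of "p - b" "p - a"] ab(3,4) by simp
      finally show ?thesis by simp
    qed
    have "U p \<subseteq> sphere 0 1" unfolding U_def using direction_in_sphere by blast
    then have "bounded (U p)" using bounded_sphere bounded_subset by blast
    moreover have "diameter (U p) \<le> 4 * tail_bound K"
      using \<open>tail_bound K \<ge> 0\<close> close by (intro diameter_le) auto
    ultimately show ?thesis ..
  qed
  moreover have "direction ` angle_set \<subseteq> \<Union>(U ` angle_net K)"
    unfolding U_def angle_set_eq by blast
  ultimately have "covering_number (4 * tail_bound K) (direction ` angle_set) \<le> card (U ` angle_net K)"
    using finite_angle_net by (intro covering_number_le) auto
  also have "\<dots> \<le> 2 ^ (22 * K\<^sup>2)"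
    using card_image_le[OF finite_angle_net] card_angle_net order_trans by blast
  finally show ?thesis .
qed

text \<open>
Along the scales \<open>\<delta> = 4 tail_bound K\<close> the quotient of logarithms is at most
\<open>22 K^2 / (2^K - 2)\<close>; one such sequence of scales suffices for a lower limit.
\<close>

lemma lower_box_dim_directions: "lower_box_dim (direction ` angle_set) = 0"
proof (rule antisym)
  let ?N = "\<lambda>\<delta>. covering_number \<delta> (direction ` angle_set)"
  let ?f = "\<lambda>\<delta>. ereal (ln (real (?N \<delta>)) / ln (1 / \<delta>))"
  have "\<forall>\<^sub>F \<delta> in at_right 0. (0::real) < \<delta> \<and> \<delta> < 1"
    by (rule eventually_at_rightI[of 0 1]) auto
  then have "\<forall>\<^sub>F \<delta> in at_right 0. 0 \<le> ?f \<delta>"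
  proof eventually_elim
    case (elim \<delta>)
    have "0 \<le> ln (real (?N \<delta>))" by (cases "?N \<delta> = 0") auto
    then show ?case using elim by (auto intro!: divide_nonneg_nonneg)
  qed
  then show "0 \<le> lower_box_dim (direction ` angle_set)"
    unfolding lower_box_dim_def by (rule Liminf_bounded)
  define \<delta> where "\<delta> K = 4 * tail_bound K" for K
  have \<delta>_eq: "\<delta> K = 2 powr (2 - 2 ^ K)" for K
    unfolding \<delta>_def tail_bound_def powr_diff by (simp add: powr_minus_divide)
  have "\<delta> \<longlonglongrightarrow> 0" unfolding \<delta>_eq by real_asymp
  then have lim: "filterlim \<delta> (at_right 0) sequentially"
    by (intro tendsto_imp_filterlim_at_right) (auto simp: \<delta>_eq)
  have upper: "?f (\<delta> K) \<le> ereal (22 * (real K)\<^sup>2 / (2 ^ K - 2))" if "K \<ge> 2" for K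
  proof -
    have "(4::real) \<le> 2 ^ K" using power_increasing[OF that, of "2::real"] by simp
    have L: "ln (1 / \<delta> K) = (2 ^ K - 2) * ln 2"
      unfolding \<delta>_eq by (simp add: ln_div ln_powr algebra_simps)
    have "ln (real (?N (\<delta> K))) \<le> 22 * (real K)\<^sup>2 * ln 2"
    proof (cases "?N (\<delta> K) = 0")
      case False
      have "real (?N (\<delta> K)) \<le> real (2 ^ (22 * K\<^sup>2))"
        unfolding \<delta>_def by (rule of_nat_mono) (rule covering_number_directions)
      then have "ln (real (?N (\<delta> K))) \<le> ln (real (2 ^ (22 * K\<^sup>2)))"
        using False by (subst ln_le_cancel_iff) auto
      also have "\<dots> = 22 * (real K)\<^sup>2 * ln 2" by (simp add: ln_realpow)
      finally show ?thesis .
    qed simp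
    then have "ln (real (?N (\<delta> K))) / ln (1 / \<delta> K)
        \<le> 22 * (real K)\<^sup>2 * ln 2 / ((2 ^ K - 2) * ln 2)"
      unfolding L by (rule divide_right_mono) (use \<open>4 \<le> 2 ^ K\<close> in simp)
    also have "\<dots> = 22 * (real K)\<^sup>2 / (2 ^ K - 2)" by simp
    finally show ?thesis by simp
  qed
  have ratio: "(\<lambda>K::nat. 22 * (real K)\<^sup>2 / (2 ^ K - 2)) \<longlonglongrightarrow> 0" by real_asymp
  show "lower_box_dim (direction ` angle_set) \<le> 0"
    unfolding lower_box_dim_def
  proof (rule Liminf_least)
    fix P assume P: "eventually P (at_right (0::real))"
    show "(INF \<delta>\<in>Collect P. ?f \<delta>) \<le> 0"
    proof (rule ereal_le_epsilon2)
      fix \<epsilon> :: real assume "\<epsilon> > 0"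
      have "\<forall>\<^sub>F K in sequentially. P (\<delta> K)" using lim P unfolding filterlim_iff by blast
      moreover have "\<forall>\<^sub>F K in sequentially. 22 * (real K)\<^sup>2 / (2 ^ K - 2) < \<epsilon>"
        using ratio \<open>\<epsilon> > 0\<close> by (rule order_tendstoD)
      ultimately have "\<forall>\<^sub>F K in sequentially. P (\<delta> K) \<and> 22 * (real K)\<^sup>2 / (2 ^ K - 2) < \<epsilon> \<and> K \<ge> 2"
        using eventually_ge_at_top[of "2::nat"] by eventually_elim blast
      then obtain K where K: "P (\<delta> K)" "22 * (real K)\<^sup>2 / (2 ^ K - 2) < \<epsilon>" "K \<ge> 2"
        using eventually_happens' sequentially_bot by blast
      have "(INF \<delta>\<in>Collect P. ?f \<delta>) \<le> ?f (\<delta> K)" using K(1) by (intro INF_lower) simp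
      also have "\<dots> \<le> ereal (22 * (real K)\<^sup>2 / (2 ^ K - 2))" using K(3) by (rule upper)
      also have "\<dots> \<le> 0 + ereal \<epsilon>" using K(2) by simp
      finally show "(INF \<delta>\<in>Collect P. ?f \<delta>) \<le> 0 + ereal \<epsilon>" .
    qed
  qed
qed

section \<open>From good angles to large projections\<close>

text \<open>
The sets of a cover that is admissible at \<open>\<delta> = 1\<close> have diameter at most \<open>1\<close>, so raising the exponent
from \<open>s\<close> to \<open>u\<close> does not increase the sum.
\<close>

lemma hausdorff_null_small_cover:
  fixes A :: "'a::metric_space set"
  assumes "hausdorff_measure s A = 0" "0 \<le> s" "s \<le> u" "\<eta> > 0"
  shows "\<exists>U :: nat \<Rightarrow> 'a set. A \<subseteq> (\<Union>i. U i) \<and> (\<forall>i. bounded (U i)) \<and> (\<Sum>i. diam_pow u (U i)) < ennreal \<eta>"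
proof -
  have "hausdorff_premeasure s 1 A \<le> hausdorff_measure s A"
    unfolding hausdorff_measure_def by (rule SUP_upper) simp
  then have "hausdorff_premeasure s 1 A < ennreal \<eta>" using assms(1,4) by simp
  then obtain U :: "nat \<Rightarrow> 'a set" where U: "A \<subseteq> (\<Union>i. U i)" "\<forall>i. bounded (U i) \<and> diameter (U i) \<le> 1"
      "(\<Sum>i. diam_pow s (U i)) < ennreal \<eta>"
    unfolding hausdorff_premeasure_def INF_less_iff by auto
  have "diam_pow u V \<le> diam_pow s V" if V: "bounded V" "diameter V \<le> 1" for V :: "'a set"
  proof -
    have "0 \<le> diameter V" using V(1) by (rule diameter_ge_0)
    then have "diameter V powr u \<le> 1" "diameter V powr u \<le> diameter V powr s"
      using V(2) assms(2,3) by (auto intro: powr_le1 powr_mono')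
    then show ?thesis unfolding diam_pow_def using assms(2,3) by (auto intro: ennreal_leI simp: ennreal_le_1)
  qed
  then have "(\<Sum>i. diam_pow u (U i)) \<le> (\<Sum>i. diam_pow s (U i))"
    using U(2) by (intro suminf_le) auto
  then show ?thesis using U by (intro exI[of _ U]) auto
qed

text \<open>
Open intervals slightly longer than the covering sets, so that compactness applies and degenerate sets
get a positive length. The excess \<open>e i\<close> is measured in terms of \<open>u\<close>-th powers and is summable.
\<close>

lemma hausdorff_null_interval_cover:
  fixes A :: "real set"
  assumes "hausdorff_measure s A = 0" "0 \<le> s" "s \<le> u" "0 < u" "\<eta> > 0"
  shows "\<exists>(z :: nat \<Rightarrow> real) d. (\<forall>i. 0 < d i) \<and> A \<subseteq> (\<Union>i. ball (z i) (d i)) \<and>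
           (\<Sum>i. ennreal (d i powr u)) < ennreal \<eta>"
proof -
  obtain U where U: "A \<subseteq> (\<Union>i. U i)" "\<And>i. bounded (U i)" "(\<Sum>i. diam_pow u (U i)) < ennreal (\<eta> / 2)"
    using hausdorff_null_small_cover[OF assms(1-3), of "\<eta> / 2"] assms(5) by auto
  define e where "e i = \<eta> / 2 * (1 / 2) ^ Suc i" for i
  have e: "e i > 0" for i unfolding e_def using assms(5) by simp
  define d where "d i = (diameter (U i) powr u + e i) powr (1 / u)" for i
  have pos: "0 < diameter (U i) powr u + e i" for i
    using e[of i] by (intro add_nonneg_pos) auto
  have d_powr: "d i powr u = diameter (U i) powr u + e i" for i
    unfolding d_def using assms(4) pos[of i] by (simp add: powr_powr)
  have d_pos: "0 < d i" for i
    unfolding d_def using pos[of i] by simp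
  have d_diam: "diameter (U i) < d i" for i
  proof (rule ccontr)
    assume "\<not> ?thesis"
    then have "d i powr u \<le> diameter (U i) powr u"
      using assms(4) d_pos[of i] by (intro powr_mono2) auto
    then show False unfolding d_powr using e[of i] by simp
  qed
  define z where "z i = (SOME z. z \<in> U i)" for i
  have "A \<subseteq> (\<Union>i. ball (z i) (d i))"
  proof
    fix x assume "x \<in> A"
    then obtain i where i: "x \<in> U i" using U(1) by blast
    then have "z i \<in> U i" unfolding z_def by (rule someI)
    then have "dist (z i) x \<le> diameter (U i)" using U(2) i by (intro diameter_bounded_bound)
    then have "x \<in> ball (z i) (d i)" using d_diam[of i] by simp
    then show "x \<in> (\<Union>i. ball (z i) (d i))" by blast
  qed
  moreover have "(\<Sum>i. ennreal (d i powr u)) < ennreal \<eta>"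
  proof -
    have "ennreal (d i powr u) = diam_pow u (U i) + ennreal (e i)" for i
      unfolding d_powr diam_pow_def using assms(4) e[of i]
      by (auto simp: diameter_def simp flip: ennreal_plus)
    then have "(\<Sum>i. ennreal (d i powr u)) = (\<Sum>i. diam_pow u (U i)) + (\<Sum>i. ennreal (e i))"
      by (simp add: suminf_add)
    also have "(\<Sum>i. ennreal (e i)) = ennreal (\<eta> / 2)"
    proof (rule suminf_ennreal_eq)
      show "e sums (\<eta> / 2)"
        unfolding e_def using sums_mult[OF power_half_series, of "\<eta> / 2"] by simp
    qed (use e less_imp_le in blast)
    also have "(\<Sum>i. diam_pow u (U i)) + ennreal (\<eta> / 2) < ennreal (\<eta> / 2) + ennreal (\<eta> / 2)"
      using U(3) by (simp add: add.commute)
    also have "\<dots> = ennreal \<eta>" using assms(5) by (simp flip: ennreal_plus)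
    finally show ?thesis .
  qed
  ultimately show ?thesis using d_pos by blast
qed

definition dyadic_level :: "real \<Rightarrow> nat" where
  "dyadic_level d = nat \<lfloor>- log 2 d\<rfloor>"

lemma dyadic_level:
  assumes "0 < d" "d \<le> 1"
  shows "d \<le> 2 powr (- real (dyadic_level d))" "2 powr (- real (dyadic_level d) - 1) < d"
proof -
  have "log 2 d \<le> 0" using assms by (simp add: log_le_zero_cancel_iff)
  then have "real (dyadic_level d) \<le> - log 2 d" "- log 2 d < real (dyadic_level d) + 1"
    unfolding dyadic_level_def by (auto simp: of_nat_nat)
  then have "log 2 d \<le> - real (dyadic_level d)" "- real (dyadic_level d) - 1 < log 2 d" by auto
  then show "d \<le> 2 powr (- real (dyadic_level d))" "2 powr (- real (dyadic_level d) - 1) < d"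
    using assms by (auto simp: log_le_iff less_log_iff)
qed

text \<open>
Group the intervals by dyadic level and let \<open>X l\<close> consist of the points whose projection is caught by an
interval of level \<open>l\<close>. The bound on the sum of \<open>u\<close>-th powers limits the number of intervals of
level \<open>l\<close> to \<open>2^(u l)\<close> and excludes levels below \<open>l0\<close>. If \<open>\<theta>\<close> were bad at no level, all the sets
\<open>X l\<close> together would have less than the full mass.
\<close>

lemma small_cover_bad_angle:
  assumes "finite F" "\<And>x. 0 \<le> m x" "0 < sum m F" "0 < u" "1 \<le> l0"
    and I: "finite I" "\<And>i. i \<in> I \<Longrightarrow> 0 < d i" "(\<Sum>i\<in>I. d i powr u) \<le> 2 powr (- u * real l0)"
      "\<And>i. i \<in> I \<Longrightarrow> dyadic_level (d i) \<le> n"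
    and cov: "ang_proj \<theta> ` F \<subseteq> (\<Union>i\<in>I. ball (z i) (d i))"
  shows "\<exists>l. l0 \<le> l \<and> l \<le> n \<and> bad_angle F m u l \<theta>"
proof (rule ccontr)
  assume no: "\<not> ?thesis"
  define X where "X l = {x \<in> F. \<exists>i\<in>I. dyadic_level (d i) = l \<and> dist (z i) (ang_proj \<theta> x) < d i}" for l
  have d_small: "d i \<le> 2 powr (- real l0)" if "i \<in> I" for i
  proof -
    have "d i powr u \<le> (\<Sum>i\<in>I. d i powr u)" using that I(1) by (intro member_le_sum) auto
    also have "\<dots> \<le> (2 powr (- real l0)) powr u" using I(3) by (simp add: powr_powr mult.commute)
    finally show ?thesis using assms(4) I(2)[OF that]
      by (metis not_le powr_less_mono2 powr_ge_zero)
  qed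
  have "(2::real) powr (- real l0) \<le> 2 powr 0" by (intro powr_mono) auto
  then have d_le_1: "d i \<le> 1" if "i \<in> I" for i using d_small[OF that] by simp
  have lev: "d i \<le> 2 powr (- real (dyadic_level (d i)))"
      "2 powr (- real (dyadic_level (d i)) - 1) < d i" if "i \<in> I" for i
    using dyadic_level[OF I(2) d_le_1] that by auto
  have lev_ge: "l0 \<le> dyadic_level (d i)" if "i \<in> I" for i
  proof -
    have "(2::real) powr (- real (dyadic_level (d i)) - 1) < 2 powr (- real l0)"
      using lev(2)[OF that] d_small[OF that] by (rule order.strict_trans2)
    then have "real l0 < real (dyadic_level (d i)) + 1" by simp
    then show ?thesis by linarith
  qed
  have tubes: "in_tubes u l \<theta> (X l)" for l
  proof -
    define I' where "I' = {i \<in> I. dyadic_level (d i) = l}"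
    have "finite I'" unfolding I'_def using I(1) by simp
    have "(2 powr (- real l - 1)) powr u = 2 powr (- u * (real l + 1))"
      unfolding powr_powr by (intro arg_cong[where f = "\<lambda>s. 2 powr s"]) (simp add: algebra_simps)
    then have "real (card I') * 2 powr (- u * (real l + 1)) = (\<Sum>i\<in>I'. (2 powr (- real l - 1)) powr u)"
      by simp
    also have "\<dots> \<le> (\<Sum>i\<in>I'. d i powr u)"
      using lev(2) assms(4) unfolding I'_def by (intro sum_mono powr_mono2) (auto simp: less_imp_le)
    also have "\<dots> \<le> (\<Sum>i\<in>I. d i powr u)" unfolding I'_def using I(1) by (intro sum_mono2) auto
    also have "\<dots> \<le> 2 powr (- u * real l0)" by (rule I(3))
    also have "\<dots> \<le> 2 powr (- u)"
      using assms(4,5) by (intro powr_mono) (auto simp: mult_le_cancel_left1)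
    finally have "real (card I') \<le> 2 powr (- u) / 2 powr (- u * (real l + 1))"
      by (simp add: pos_le_divide_eq)
    also have "\<dots> = 2 powr (u * real l)"
      unfolding powr_diff[symmetric] by (simp add: algebra_simps)
    finally have "real (card (z ` I')) \<le> 2 powr (u * real l)"
      using card_image_le[OF \<open>finite I'\<close>, of z] by linarith
    moreover have "\<exists>w\<in>z ` I'. \<bar>ang_proj \<theta> x - w\<bar> \<le> 2 powr (- real l)" if x: "x \<in> X l" for x
    proof -
      obtain i where i: "i \<in> I" "dyadic_level (d i) = l" "dist (z i) (ang_proj \<theta> x) < d i"
        using x unfolding X_def by blast
      then have "\<bar>ang_proj \<theta> x - z i\<bar> \<le> 2 powr (- real l)"
        using lev(1)[OF i(1)] by (simp add: dist_real_def abs_minus_commute)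
      then show ?thesis using i unfolding I'_def by blast
    qed
    ultimately show ?thesis unfolding in_tubes_def using \<open>finite I'\<close> by blast
  qed
  have "F \<subseteq> (\<Union>l\<in>{l0..n}. X l)"
  proof
    fix x assume x: "x \<in> F"
    then obtain i where i: "i \<in> I" "dist (z i) (ang_proj \<theta> x) < d i"
      using cov by (force simp: image_subset_iff)
    then have "x \<in> X (dyadic_level (d i))" using x unfolding X_def by blast
    then show "x \<in> (\<Union>l\<in>{l0..n}. X l)" using lev_ge I(4) i(1) by auto
  qed
  then have "sum m F \<le> (\<Sum>l\<in>{l0..n}. sum m (X l))"
    using assms(1,2) by (intro sum_le_sum_cover) (auto simp: X_def)
  also have "\<dots> \<le> (\<Sum>l\<in>{l0..n}. sum m F / real ((l + 1) * (l + 2)))"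
  proof (rule sum_mono)
    fix l assume "l \<in> {l0..n}"
    then have "\<not> bad_angle F m u l \<theta>" using no by auto
    moreover have "X l \<subseteq> F" unfolding X_def by blast
    ultimately show "sum m (X l) \<le> sum m F / real ((l + 1) * (l + 2))"
      unfolding bad_angle_def using tubes by (meson linear)
  qed
  also have "\<dots> \<le> (\<Sum>l\<le>n. sum m F / real ((l + 1) * (l + 2)))"
    using assms(3) by (intro sum_mono2) (auto simp del: of_nat_mult)
  also have "\<dots> = sum m F * (\<Sum>l\<le>n. 1 / (real (l + 1) * real (l + 2)))"
    unfolding sum_distrib_left by (intro sum.cong) (simp_all only: of_nat_mult times_divide_eq_right mult_1_right)
  also have "\<dots> < sum m F * 1"
    unfolding sum_telescope_inverse using assms(3) by (intro mult_strict_left_mono) auto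
  finally show False by simp
qed

text \<open>
Let \<open>\<theta> n\<close> be good for weights of resolution \<open>n\<close>, and \<open>\<phi>\<close> a limit point of the
sequence. An economical cover of the projection of \<open>K j\<close> at the angle \<open>\<phi>\<close> may be taken finite and
open. It then covers the projection at every angle near \<open>\<phi>\<close>, and all its levels are at most \<open>n\<close> for
large \<open>n\<close>, so some \<open>\<theta> n\<close> would be bad.
\<close>

lemma exists_universal_angle:
  fixes K :: "nat \<Rightarrow> (real^2) set"
  assumes K: "\<And>j. compact (K j)" "\<And>j. ennreal (c j) \<le> net_content (t j) (K j)" "\<And>j. 0 < c j"
    and tu: "\<And>j. 0 < u j" "\<And>j. 2 * u j < t j"
  shows "\<exists>\<theta>\<in>angle_set. \<forall>j s. 0 \<le> s \<longrightarrow> s \<le> u j \<longrightarrow> hausdorff_measure s (ang_proj \<theta> ` K j) \<noteq> 0"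
proof -
  have "\<exists>l. j \<le> l \<and> 1 \<le> l \<and> (\<forall>l'\<ge>l. scale_ok (t j) (u j) (c j) (digit_pos (scale_block l')) l')" for j
  proof -
    have "0 < t j" using tu[of j] by linarith
    then obtain l where "\<forall>l'\<ge>l. scale_ok (t j) (u j) (c j) (digit_pos (scale_block l')) l'"
      using eventually_scale_ok[OF _ tu(2) K(3)] unfolding eventually_sequentially by blast
    then show ?thesis by (intro exI[of _ "max l (max j 1)"]) auto
  qed
  then obtain l0 where l0: "\<And>j. j \<le> l0 j" "\<And>j. 1 \<le> l0 j"
      "\<And>j l. l0 j \<le> l \<Longrightarrow> scale_ok (t j) (u j) (c j) (digit_pos (scale_block l)) l"
    by metis
  have "\<forall>n j. \<exists>q. frostman_weight (t j) n (fst q) (snd q) \<and> fst q \<subseteq> K j \<and> sum (snd q) (fst q) = c j"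
    using exists_frostman_weight[OF compact_imp_bounded[OF K(1)] K(3) K(2)] by simp
  then obtain q where q: "\<forall>n j. frostman_weight (t j) n (fst (q n j)) (snd (q n j)) \<and>
      fst (q n j) \<subseteq> K j \<and> sum (snd (q n j)) (fst (q n j)) = c j"
    unfolding choice_iff ..
  define F m where "F n j = fst (q n j)" and "m n j = snd (q n j)" for n j
  have Fm: "\<And>n j. frostman_weight (t j) n (F n j) (m n j)"
      "\<And>n j. F n j \<subseteq> K j" "\<And>n j. sum (m n j) (F n j) = c j"
    unfolding F_def m_def using q by blast+
  have "\<exists>\<theta>\<in>angle_set. \<forall>j l. l0 j \<le> l \<longrightarrow> l \<le> n \<longrightarrow> \<not> bad_angle (F n j) (m n j) (u j) l \<theta>" for n
    using exists_good_angle[OF Fm(1) Fm(3) K(3) l0] .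
  then obtain \<theta> where \<theta>: "\<And>n. \<theta> n \<in> angle_set"
      "\<And>n j l. l0 j \<le> l \<Longrightarrow> l \<le> n \<Longrightarrow> \<not> bad_angle (F n j) (m n j) (u j) l (\<theta> n)"
    by metis
  obtain \<phi> r where \<phi>: "\<phi> \<in> angle_set" "strict_mono r" "(\<theta> \<circ> r) \<longlonglongrightarrow> \<phi>"
    using compact_imp_seq_compact[OF compact_angle_set] \<theta>(1) unfolding seq_compact_def by blast
  have "hausdorff_measure s (ang_proj \<phi> ` K j) \<noteq> 0" if s: "0 \<le> s" "s \<le> u j" for j s
  proof
    assume "hausdorff_measure s (ang_proj \<phi> ` K j) = 0"
    then have "\<exists>(z :: nat \<Rightarrow> real) d. (\<forall>i. 0 < d i) \<and> ang_proj \<phi> ` K j \<subseteq> (\<Union>i. ball (z i) (d i)) \<and>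
        (\<Sum>i. ennreal (d i powr u j)) < ennreal (2 powr (- u j * real (l0 j)))"
      using s tu(1) by (rule hausdorff_null_interval_cover) simp
    then obtain z d where zd: "\<And>i. 0 < d i" "ang_proj \<phi> ` K j \<subseteq> (\<Union>i :: nat. ball (z i) (d i))"
        "(\<Sum>i. ennreal (d i powr u j)) < ennreal (2 powr (- u j * real (l0 j)))"
      by blast
    have "continuous_on (K j) (ang_proj \<phi>)"
      unfolding ang_proj_def by (intro continuous_intros)
    then have comp: "compact (ang_proj \<phi> ` K j)" using K(1) by (rule compact_continuous_image)
    then obtain I where I: "finite I" "ang_proj \<phi> ` K j \<subseteq> (\<Union>i\<in>I. ball (z i) (d i))"
      using zd(2) by (rule compactE_image[OF _ open_ball])
    have "ennreal (\<Sum>i\<in>I. d i powr u j) = (\<Sum>i\<in>I. ennreal (d i powr u j))" by simp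
    also have "\<dots> \<le> (\<Sum>i. ennreal (d i powr u j))" using I(1) by (intro sum_le_suminf) auto
    also have "\<dots> \<le> ennreal (2 powr (- u j * real (l0 j)))" using zd(3) by (rule less_imp_le)
    finally have sum_le: "(\<Sum>i\<in>I. d i powr u j) \<le> 2 powr (- u j * real (l0 j))"
      by (subst (asm) ennreal_le_iff) auto
    obtain \<rho> where \<rho>: "\<rho> > 0" "(\<Union>y\<in>ang_proj \<phi> ` K j. ball y \<rho>) \<subseteq> (\<Union>i\<in>I. ball (z i) (d i))"
      using compact_subset_open_imp_ball_epsilon_subset[OF comp _ I(2)] by blast
    obtain R where R: "R > 0" "\<And>x. x \<in> K j \<Longrightarrow> norm x \<le> R"
      using compact_imp_bounded[OF K(1)] unfolding bounded_pos by blast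
    define N where "N = Max (insert 0 ((\<lambda>i. dyadic_level (d i)) ` I))"
    have N: "dyadic_level (d i) \<le> N" if "i \<in> I" for i
      unfolding N_def using that I(1) by (intro Max_ge) auto
    have "\<forall>\<^sub>F n in sequentially. dist ((\<theta> \<circ> r) n) \<phi> < \<rho> / (2 * R)"
      by (rule tendstoD[OF \<phi>(3)]) (use \<rho>(1) R(1) in simp)
    then obtain n where n: "n \<ge> N" "dist (\<theta> (r n)) \<phi> < \<rho> / (2 * R)"
      unfolding eventually_sequentially by (metis comp_apply le_cases)
    have "r n \<ge> N" using n(1) seq_suble[OF \<phi>(2), of n] by linarith
    have cov: "ang_proj (\<theta> (r n)) ` F (r n) j \<subseteq> (\<Union>i\<in>I. ball (z i) (d i))"
    proof (rule image_subsetI)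
      fix x assume "x \<in> F (r n) j"
      then have x: "x \<in> K j" using Fm(2) by blast
      have "\<bar>ang_proj \<phi> x - ang_proj (\<theta> (r n)) x\<bar> \<le> 2 * norm x * \<bar>\<phi> - \<theta> (r n)\<bar>"
        by (rule ang_proj_lipschitz)
      also have "\<dots> \<le> 2 * R * \<bar>\<phi> - \<theta> (r n)\<bar>"
        using R(2)[OF x] by (intro mult_right_mono) auto
      also have "\<dots> < \<rho>"
        using n(2) R(1) by (simp add: dist_real_def abs_minus_commute field_simps)
      finally have "ang_proj (\<theta> (r n)) x \<in> ball (ang_proj \<phi> x) \<rho>" by (simp add: dist_real_def)
      then show "ang_proj (\<theta> (r n)) x \<in> (\<Union>i\<in>I. ball (z i) (d i))" using \<rho>(2) x by blast
    qed
    have "finite (F (r n) j)" "\<And>x. 0 \<le> m (r n) j x" "0 < sum (m (r n) j) (F (r n) j)"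
      using Fm(1)[of j "r n"] Fm(3)[of "r n" j] K(3)[of j] unfolding frostman_weight_def by auto
    then have "\<exists>l. l0 j \<le> l \<and> l \<le> r n \<and> bad_angle (F (r n) j) (m (r n) j) (u j) l (\<theta> (r n))"
      using N \<open>r n \<ge> N\<close> order_trans
      by (intro small_cover_bad_angle[OF _ _ _ tu(1) l0(2) I(1) zd(1) sum_le _ cov]) blast+
    then show False using \<theta>(2) by blast
  qed
  then show ?thesis using \<phi>(1) by blast
qed

lemma hausdorff_measure_mono:
  assumes "A \<subseteq> B"
  shows "hausdorff_measure s A \<le> hausdorff_measure s B"
proof -
  have "hausdorff_premeasure s \<delta> A \<le> hausdorff_premeasure s \<delta> B" for \<delta>
    unfolding hausdorff_premeasure_def using assms by (intro INF_superset_mono) auto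
  then show ?thesis unfolding hausdorff_measure_def by (intro SUP_mono) auto
qed

lemma hausdorff_measure_nonzero_below_dim:
  assumes "0 \<le> t" "ereal t < hausdorff_dim E"
  shows "hausdorff_measure t E \<noteq> 0"
proof
  assume "hausdorff_measure t E = 0"
  then have "hausdorff_dim E \<le> ereal t"
    unfolding hausdorff_dim_def using assms(1) by (intro INF_lower) simp
  then show False using assms(2) by simp
qed

text \<open>
If the projection had dimension less than \<open>dim E / 2\<close>, then it would be null for some \<open>s\<close> with
\<open>2 s < dim E\<close>, and there are rational \<open>t\<close> and \<open>u\<close> with \<open>2 s < 2 u < t < dim E\<close>. So it suffices to have one
angle that serves the countably many pairs of such rationals.
\<close>

lemma exists_direction_half_dim:
  assumes "analytic_set E"
  shows "\<exists>\<theta>\<in>angle_set. hausdorff_dim E / 2 \<le> hausdorff_dim (ang_proj \<theta> ` E)"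
proof -
  define S where "S = {(t, u). t \<in> \<rat> \<and> u \<in> \<rat> \<and> 0 < u \<and> 2 * u < t \<and> ereal t < hausdorff_dim E}"
  have "countable S"
    by (rule countable_subset[of _ "\<rat> \<times> \<rat>"]) (auto simp: S_def intro: countable_rat)
  have reduce: "hausdorff_dim E / 2 \<le> hausdorff_dim (ang_proj \<theta> ` E)"
    if good: "\<And>t u s. (t, u) \<in> S \<Longrightarrow> 0 \<le> s \<Longrightarrow> s \<le> u \<Longrightarrow> hausdorff_measure s (ang_proj \<theta> ` E) \<noteq> 0" for \<theta>
    unfolding hausdorff_dim_def[of "ang_proj \<theta> ` E"]
  proof (rule INF_greatest, rule ccontr)
    fix s assume s: "s \<in> {s. 0 \<le> s \<and> hausdorff_measure s (ang_proj \<theta> ` E) = 0}"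
      and "\<not> hausdorff_dim E / 2 \<le> ereal s"
    then have "ereal s < hausdorff_dim E / 2" by simp
    then have "ereal (2 * s) < hausdorff_dim E"
      by (cases "hausdorff_dim E") (auto simp: field_simps)
    then obtain t' where t': "2 * s < t'" "ereal t' < hausdorff_dim E"
      using ereal_dense2 by force
    obtain t where t: "t \<in> \<rat>" "2 * s < t" "t < t'" using Rats_dense_in_real[OF t'(1)] by blast
    have "s < t / 2" using t(2) by simp
    then obtain u where u: "u \<in> \<rat>" "s < u" "u < t / 2" using Rats_dense_in_real by blast
    have "ereal t < hausdorff_dim E" using t(3) t'(2) by (meson ereal_less_eq(3) less_imp_le order_le_less_trans)
    then have "(t, u) \<in> S" unfolding S_def using t u s by auto
    then show False using good[of t u s] s u(2) by auto
  qed
  show ?thesis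
  proof (cases "S = {}")
    case True
    have "angle_sum 0 (\<lambda>_. 0) \<in> angle_set"
      by (rule angle_sum_in_angle_set) (simp add: digit_bound_def)
    then show ?thesis using reduce True by blast
  next
    case False
    define t u where "t j = fst (from_nat_into S j)" and "u j = snd (from_nat_into S j)" for j
    have tu: "(t j, u j) \<in> S" for j
      unfolding t_def u_def using from_nat_into[OF False, of j] by simp
    have "\<exists>K c. compact K \<and> K \<subseteq> E \<and> c > 0 \<and> ennreal c \<le> net_content (t j) K" for j
    proof (rule analytic_has_compact_subset[OF assms])
      have "0 < t j" "ereal (t j) < hausdorff_dim E" using tu[of j] unfolding S_def by auto
      then show "net_content (t j) E \<noteq> 0"
        using hausdorff_null_if_net_null hausdorff_measure_nonzero_below_dim less_imp_le by metis
    qed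
    then obtain K c where K: "\<And>j. compact (K j)" "\<And>j. K j \<subseteq> E" "\<And>j. 0 < c j"
        "\<And>j. ennreal (c j) \<le> net_content (t j) (K j)"
      by metis
    have pos: "0 < u j" "2 * u j < t j" for j using tu[of j] unfolding S_def by auto
    obtain \<theta> where \<theta>: "\<theta> \<in> angle_set"
        "\<And>j s. 0 \<le> s \<Longrightarrow> s \<le> u j \<Longrightarrow> hausdorff_measure s (ang_proj \<theta> ` K j) \<noteq> 0"
      using exists_universal_angle[of K c t u, OF K(1) K(4) K(3) pos] by metis
    have "hausdorff_measure s (ang_proj \<theta> ` E) \<noteq> 0"
      if S': "(t', u') \<in> S" and s: "0 \<le> s" "s \<le> u'" for t' u' s
    proof
      assume null: "hausdorff_measure s (ang_proj \<theta> ` E) = 0"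
      obtain j where "from_nat_into S j = (t', u')"
        using from_nat_into_surj[OF \<open>countable S\<close> S'] by blast
      then have "s \<le> u j" unfolding u_def using s(2) by simp
      moreover have "hausdorff_measure s (ang_proj \<theta> ` K j) = 0"
        using hausdorff_measure_mono[OF image_mono[OF K(2)], of s "ang_proj \<theta>" j] null by simp
      ultimately show False using \<theta>(2) s(1) by blast
    qed
    then show ?thesis using reduce \<theta>(1) by blast
  qed
qed

theorem theorem5:
  "\<exists>D \<subseteq> sphere (0 :: real^2) 1.
     lower_box_dim D = 0 \<and> bourgain_universal D {E. analytic_set E}"
proof (intro exI conjI)
  let ?D = "direction ` angle_set"
  show sphere: "?D \<subseteq> sphere 0 1" using direction_in_sphere by blast
  show "lower_box_dim ?D = 0" by (rule lower_box_dim_directions)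
  show "bourgain_universal ?D {E. analytic_set E}"
    unfolding bourgain_universal_def using sphere exists_direction_half_dim dir_proj_direction by fastforce
qed

end
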